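(* For every integer $k\ge1$, let $\mathcal{C}=\mathrm{Av}(k\cdots1)$ be the class of permutations avoiding the decreasing permutation $k(k-1)\cdots1$. Then $\lim_{n\to\infty}|\mathcal{C}^{rc}_{2n}|^{1/n}$ exists and equals $\lim_{n\to\infty}|\mathcal{C}_n|^{1/n}$.
   Context: A permutation of size $n$ is a bijection of $[n]$; $\pi$ contains $\sigma$ if some subsequence of $\pi$ has the same relative order as $\sigma$, and avoids it otherwise; $\mathcal{C}_n$ is the set of size-$n$ elements of $\mathcal{C}$. For $\pi$ of size $n$, $\mathrm{rc}(\pi)(i)=n+1-\pi(n+1-i)$; $\pi$ is centrosymmetric if $\mathrm{rc}(\pi)=\pi$; $\mathcal{C}^{rc}_n$ is the set of centrosymmetric elements of $\mathcal{C}_n$. *)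

theory Defs
  imports Complex_Main "HOL-Combinatorics.Permutations"
begin

text \<open>A permutation of size \<open>n\<close> is a function with \<open>\<pi> permutes {1..n}\<close>; it is the identity outside
  \<open>{1..n}\<close>, so the size is not determined by the function and is passed explicitly. Accordingly a
  class of permutations is given by its family of size-\<open>n\<close> slices.\<close>

definition contains_pattern :: "nat \<Rightarrow> (nat \<Rightarrow> nat) \<Rightarrow> nat \<Rightarrow> (nat \<Rightarrow> nat) \<Rightarrow> bool" where
  "contains_pattern n \<pi> m \<sigma> \<longleftrightarrow>
     (\<exists>f. strict_mono_on {1..m} f \<and> f ` {1..m} \<subseteq> {1..n} \<and>
          (\<forall>i\<in>{1..m}. \<forall>j\<in>{1..m}. \<pi> (f i) < \<pi> (f j) \<longleftrightarrow> \<sigma> i < \<sigma> j))"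

definition Av :: "nat \<Rightarrow> (nat \<Rightarrow> nat) \<Rightarrow> nat \<Rightarrow> (nat \<Rightarrow> nat) set" where
  "Av m \<sigma> n = {\<pi>. \<pi> permutes {1..n} \<and> \<not> contains_pattern n \<pi> m \<sigma>}"

definition decreasing_perm :: "nat \<Rightarrow> nat \<Rightarrow> nat" where
  "decreasing_perm k i = (if i \<in> {1..k} then k + 1 - i else i)"

definition rc :: "nat \<Rightarrow> (nat \<Rightarrow> nat) \<Rightarrow> nat \<Rightarrow> nat" where
  "rc n \<pi> i = (if i \<in> {1..n} then n + 1 - \<pi> (n + 1 - i) else i)"

definition centrosymmetric :: "nat \<Rightarrow> (nat \<Rightarrow> nat) \<Rightarrow> bool" where
  "centrosymmetric n \<pi> \<longleftrightarrow> rc n \<pi> = \<pi>"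

definition rc_slice :: "(nat \<Rightarrow> (nat \<Rightarrow> nat) set) \<Rightarrow> nat \<Rightarrow> (nat \<Rightarrow> nat) set" where
  "rc_slice C n = {\<pi> \<in> C n. centrosymmetric n \<pi>}"

lemma decreasing_perm_permutes: "decreasing_perm k permutes {1..k}"
proof (rule bij_imp_permutes)
  show "bij_betw (decreasing_perm k) {1..k} {1..k}"
    by (rule bij_betw_byWitness[where f' = "decreasing_perm k"]) (auto simp: decreasing_perm_def)
qed (auto simp: decreasing_perm_def)

end

theory Submission
  imports Defs "HOL-Library.Infinite_Set" "HOL-Real_Asymp.Real_Asymp"
begin

text \<open>
  Write \<open>d = k - 1\<close>; both limits are \<open>d\<^sup>2\<close>. A permutation lies in the class iff its positions have
  a colouring by \<open>d\<close> colours that increases strictly along inversions. The direct sum of \<open>\<pi>\<close> and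
  its reverse complement therefore embeds the size-\<open>n\<close> members of the class into the centrosymmetric
  members of size \<open>2 n\<close>.

  Upper bound: a centrosymmetric member of the class has such a colouring for which the half turn
  reverses the order of the colours. The permutation increases on each colour class, so it is
  determined by the colours of its first \<open>n\<close> positions and of its first \<open>n\<close> values, and there are at
  most \<open>d\<close> to the power \<open>2 n\<close> of them.

  Lower bound: a pair of ballot words in which each of \<open>d\<close> letters occurs \<open>m\<close> times gives a
  permutation of size \<open>d m\<close> in the class, and the pair can be recovered from it because the first
  word is the least possible colouring. To obtain many ballot words, put arbitrary balanced blocks,
  in which each letter occurs \<open>B\<close> times, between a prefix that gives each letter a lead of \<open>B\<close> over
  the next one and a suffix that evens the counts out. The number of balanced blocks is \<open>d\<close> to the
  power \<open>d B\<close>, up to a factor polynomial in \<open>B\<close>. Direct sums make the sizes of the class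
  supermultiplicative, so special sizes suffice by Fekete's lemma.
\<close>

subsection \<open>Decreasing subsequences and colourings\<close>

definition dec_class :: "nat \<Rightarrow> nat \<Rightarrow> (nat \<Rightarrow> nat) set" where
  "dec_class d = Av (Suc d) (decreasing_perm (Suc d))"

definition inversion_colouring ::
  "nat \<Rightarrow> 'a::linorder set \<Rightarrow> ('a \<Rightarrow> 'b::linorder) \<Rightarrow> ('a \<Rightarrow> nat) \<Rightarrow> bool" where
  "inversion_colouring d S \<pi> c \<longleftrightarrow>
     (\<forall>p\<in>S. c p < d) \<and> (\<forall>p\<in>S. \<forall>q\<in>S. p < q \<and> \<pi> q < \<pi> p \<longrightarrow> c p < c q)"

lemma inversion_colouring_less: "inversion_colouring d S \<pi> c \<Longrightarrow> p \<in> S \<Longrightarrow> c p < d"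
  by (simp add: inversion_colouring_def)

lemma inversion_colouring_mono:
  "inversion_colouring d S \<pi> c \<Longrightarrow> p \<in> S \<Longrightarrow> q \<in> S \<Longrightarrow> p < q \<Longrightarrow> \<pi> q < \<pi> p \<Longrightarrow> c p < c q"
  by (simp add: inversion_colouring_def)

lemma card_le_if_inversion_colouring:
  assumes colouring: "inversion_colouring d S \<pi> c" and antimono: "T \<subseteq> S" "strict_antimono_on T \<pi>"
  shows "card T \<le> d"
proof -
  have "c p < c q" if "p \<in> T" "q \<in> T" "p < q" for p q
    using inversion_colouring_mono[OF colouring] monotone_onD[OF antimono(2)] antimono(1) that
    by blast
  then have "inj_on c T"
    by (metis inj_onI linorder_neqE order.irrefl)
  moreover have "c ` T \<subseteq> {..<d}"
    using inversion_colouring_less[OF colouring] antimono(1) by blast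
  ultimately show ?thesis
    using card_inj_on_le[of c T "{..<d}"] by simp
qed

lemma strict_antimono_on_insert_below_Min:
  fixes \<pi> :: "'a::linorder \<Rightarrow> 'b::order"
  assumes antimono: "finite T" "T \<noteq> {}" "strict_antimono_on T \<pi>"
    and extends: "p < Min T" "\<pi> (Min T) < \<pi> p"
  shows "strict_antimono_on (insert p T) \<pi>"
proof -
  have "p < q \<and> \<pi> q < \<pi> p" if "q \<in> T" for q
    using Min_le[OF antimono(1) that] monotone_onD[OF antimono(3) Min_in[OF antimono(1,2)] that]
      extends
    by (auto simp: order.order_iff_strict intro: order.strict_trans)
  then show ?thesis
    using antimono(3) by (auto simp: monotone_on_def dest: order.asym)
qed

text \<open>The points that end no inversion get colour \<open>0\<close>. Every decreasing subsequence of the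
  remaining points can be extended to the left, which makes room for an induction on \<open>d\<close>.\<close>

lemma ex_inversion_colouring:
  assumes "finite S" "\<And>T. T \<subseteq> S \<Longrightarrow> strict_antimono_on T \<pi> \<Longrightarrow> card T \<le> d"
  shows "\<exists>c. inversion_colouring d S \<pi> c"
  using assms
proof (induction d arbitrary: S)
  case 0
  have "S = {}"
    using "0.prems"(2)[of "{p}" for p] by (force simp: monotone_on_def)
  then show ?case
    by (simp add: inversion_colouring_def)
next
  case (Suc d)
  define S' where "S' = {q \<in> S. \<exists>p\<in>S. p < q \<and> \<pi> q < \<pi> p}"
  have "card T \<le> d" if antimono: "T \<subseteq> S'" "strict_antimono_on T \<pi>" for T
  proof (cases "T = {}")
    case False
    have "finite T"
      using antimono(1) Suc.prems(1) by (auto simp: S'_def intro: finite_subset)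
    then have "Min T \<in> T"
      using False by simp
    then obtain p where extends: "p \<in> S" "p < Min T" "\<pi> (Min T) < \<pi> p"
      using antimono(1) by (auto simp: S'_def)
    have "strict_antimono_on (insert p T) \<pi>"
      by (rule strict_antimono_on_insert_below_Min[OF \<open>finite T\<close> False antimono(2) extends(2,3)])
    moreover have "insert p T \<subseteq> S"
      using extends(1) antimono(1) by (auto simp: S'_def)
    ultimately have "card (insert p T) \<le> Suc d"
      using Suc.prems(2) by blast
    moreover have "p \<notin> T"
      using Min_le[OF \<open>finite T\<close>, of p] extends(2) by auto
    ultimately show ?thesis
      using \<open>finite T\<close> by simp
  qed simp
  moreover have "finite S'"
    using Suc.prems(1) by (simp add: S'_def)
  ultimately obtain c where colouring: "inversion_colouring d S' \<pi> c"
    using Suc.IH by blast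
  then have "inversion_colouring (Suc d) S \<pi> (\<lambda>p. if p \<in> S' then Suc (c p) else 0)"
    by (auto simp: inversion_colouring_def S'_def)
  then show ?case
    by blast
qed

lemma ex_strict_mono_on_enumeration:
  fixes S :: "'a::wellorder set"
  assumes "finite S"
  shows "\<exists>f. strict_mono_on {1..card S} f \<and> f ` {1..card S} = S"
proof -
  obtain h where enumeration: "bij_betw h {..<card S} S" "strict_mono_on {..<card S} h"
    using ex_bij_betw_strict_mono_card[OF assms] .
  have "strict_mono_on {1..card S} (\<lambda>i. h (i - 1))"
    using strict_mono_onD[OF enumeration(2)] by (auto simp: strict_mono_on_def)
  moreover have "(\<lambda>i. i - 1) ` {1..card S} = {..<card S}"
    by (auto simp: image_iff intro!: bexI[of _ "Suc _"])
  then have "(\<lambda>i. h (i - 1)) ` {1..card S} = S"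
    using enumeration(1) by (metis bij_betw_imp_surj_on image_image)
  ultimately show ?thesis
    by blast
qed

lemma contains_decreasing_perm_iff:
  "contains_pattern n \<pi> k (decreasing_perm k) \<longleftrightarrow>
     (\<exists>S\<subseteq>{1..n}. card S = k \<and> strict_antimono_on S \<pi>)"
proof
  assume "contains_pattern n \<pi> k (decreasing_perm k)"
  then obtain f where embedding: "strict_mono_on {1..k} f" "f ` {1..k} \<subseteq> {1..n}"
    and pattern: "\<And>i j. i \<in> {1..k} \<Longrightarrow> j \<in> {1..k} \<Longrightarrow>
      \<pi> (f i) < \<pi> (f j) \<longleftrightarrow> decreasing_perm k i < decreasing_perm k j"
    unfolding contains_pattern_def by metis
  have "card (f ` {1..k}) = k"
    using embedding(1) by (simp add: card_image strict_mono_on_imp_inj_on)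
  moreover have "strict_antimono_on (f ` {1..k}) \<pi>"
  proof (intro monotone_onI, safe)
    fix i j assume "i \<in> {1..k}" "j \<in> {1..k}" "f i < f j"
    moreover from this have "i < j"
      using strict_mono_on_less[OF embedding(1)] by blast
    ultimately show "\<pi> (f j) < \<pi> (f i)"
      using pattern[of j i] by (simp add: decreasing_perm_def)
  qed
  ultimately show "\<exists>S\<subseteq>{1..n}. card S = k \<and> strict_antimono_on S \<pi>"
    using embedding(2) by blast
next
  assume "\<exists>S\<subseteq>{1..n}. card S = k \<and> strict_antimono_on S \<pi>"
  then obtain S where antimono: "S \<subseteq> {1..n}" "card S = k" "strict_antimono_on S \<pi>"
    by blast
  then obtain f where embedding: "strict_mono_on {1..k} f" "f ` {1..k} = S"
    using ex_strict_mono_on_enumeration[of S] finite_subset by blast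
  have "\<pi> (f i) < \<pi> (f j) \<longleftrightarrow> decreasing_perm k i < decreasing_perm k j"
    if range: "i \<in> {1..k}" "j \<in> {1..k}" for i j
  proof -
    have "\<pi> (f j) < \<pi> (f i)" if "i \<in> {1..k}" "j \<in> {1..k}" "i < j" for i j
      using that embedding(2) monotone_onD[OF antimono(3)] strict_mono_onD[OF embedding(1)] by blast
    then show ?thesis
      using range by (cases i j rule: linorder_cases) (force simp: decreasing_perm_def)+
  qed
  then show "contains_pattern n \<pi> k (decreasing_perm k)"
    unfolding contains_pattern_def using embedding antimono(1) by blast
qed

lemma dec_class_iff:
  "\<pi> \<in> dec_class d n \<longleftrightarrow>
     \<pi> permutes {1..n} \<and> (\<exists>c. inversion_colouring d {1..n} \<pi> c)"
proof -
  have "(\<exists>S\<subseteq>{1..n}. card S = Suc d \<and> strict_antimono_on S \<pi>) \<longleftrightarrow>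
      \<not> (\<exists>c. inversion_colouring d {1..n} \<pi> c)"
  proof
    assume "\<exists>S\<subseteq>{1..n}. card S = Suc d \<and> strict_antimono_on S \<pi>"
    then show "\<not> (\<exists>c. inversion_colouring d {1..n} \<pi> c)"
      by (metis card_le_if_inversion_colouring Suc_n_not_le_n)
  next
    assume "\<not> (\<exists>c. inversion_colouring d {1..n} \<pi> c)"
    then obtain T where long_antimono: "T \<subseteq> {1..n}" "strict_antimono_on T \<pi>" "Suc d \<le> card T"
      using ex_inversion_colouring[of "{1..n}" \<pi> d] by (metis finite_atLeastAtMost not_less_eq_eq)
    then obtain S where subset: "S \<subseteq> T" "card S = Suc d"
      by (meson obtain_subset_with_card_n)
    then show "\<exists>S\<subseteq>{1..n}. card S = Suc d \<and> strict_antimono_on S \<pi>"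
      using long_antimono(1) monotone_on_subset[OF long_antimono(2) subset(1)] by auto
  qed
  then show ?thesis
    by (auto simp: dec_class_def Av_def contains_decreasing_perm_iff)
qed

lemma finite_dec_class: "finite (dec_class d n)"
  by (rule finite_subset[OF _ finite_permutations[of "{1..n}"]]) (auto simp: dec_class_iff)

lemma finite_rc_slice_dec_class: "finite (rc_slice (dec_class d) n)"
  by (rule finite_subset[OF _ finite_dec_class]) (auto simp: rc_slice_def)

lemma id_in_dec_class: "1 \<le> d \<Longrightarrow> id \<in> dec_class d n"
  by (auto simp: dec_class_iff permutes_id inversion_colouring_def intro!: exI[of _ "\<lambda>_. 0"])

subsection \<open>Direct sums and half turns\<close>

definition direct_sum :: "nat \<Rightarrow> (nat \<Rightarrow> nat) \<Rightarrow> (nat \<Rightarrow> nat) \<Rightarrow> nat \<Rightarrow> nat" where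
  "direct_sum m \<pi> \<tau> p = (if p \<le> m then \<pi> p else m + \<tau> (p - m))"

lemma permutes_le_iff:
  assumes "\<pi> permutes {1..n::nat}"
  shows "\<pi> p \<le> n \<longleftrightarrow> p \<le> n"
  using permutes_in_image[OF assms, of p] permutes_not_in[OF assms, of p]
  by (cases "p \<in> {1..n}") auto

lemma permutes_eq_0_iff:
  assumes "\<pi> permutes {1..n::nat}"
  shows "\<pi> p = 0 \<longleftrightarrow> p = 0"
  using permutes_in_image[OF assms, of p] permutes_not_in[OF assms, of p]
  by (cases "p \<in> {1..n}") auto

lemma direct_sum_permutes:
  assumes perm_left: "\<pi> permutes {1..m}" and perm_right: "\<tau> permutes {1..n}"
  shows "direct_sum m \<pi> \<tau> permutes {1..m+n}"
proof (rule bij_imp_permutes)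
  have left_inverse: "direct_sum m (inv \<rho>) (inv \<sigma>) (direct_sum m \<rho> \<sigma> p) = p"
    if "\<rho> permutes {1..m}" "\<sigma> permutes {1..n}" for \<rho> \<sigma> p
    using that permutes_le_iff permutes_eq_0_iff[OF that(2), of "p - m"]
    by (simp add: direct_sum_def permutes_inverses)
  have closed: "direct_sum m \<rho> \<sigma> p \<in> {1..m+n}"
    if "\<rho> permutes {1..m}" "\<sigma> permutes {1..n}" "p \<in> {1..m+n}" for \<rho> \<sigma> p
    using that permutes_le_iff[OF that(1), of p] permutes_eq_0_iff[OF that(1), of p]
      permutes_le_iff[OF that(2), of "p - m"] permutes_eq_0_iff[OF that(2), of "p - m"]
    by (auto simp: direct_sum_def Suc_le_eq)
  show "bij_betw (direct_sum m \<pi> \<tau>) {1..m+n} {1..m+n}"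
    using left_inverse[OF perm_left perm_right]
      left_inverse[OF permutes_inv[OF perm_left] permutes_inv[OF perm_right]]
      closed[OF perm_left perm_right]
      closed[OF permutes_inv[OF perm_left] permutes_inv[OF perm_right]]
    by (intro bij_betw_byWitness[where f' = "direct_sum m (inv \<pi>) (inv \<tau>)"])
      (auto simp: permutes_inv_inv[OF perm_left] permutes_inv_inv[OF perm_right])
  show "direct_sum m \<pi> \<tau> p = p" if "p \<notin> {1..m+n}" for p
    using that permutes_not_in[OF perm_left, of p] permutes_not_in[OF perm_right, of "p - m"]
    by (auto simp: direct_sum_def le_diff_conv)
qed

lemma inversion_colouring_direct_sum:
  assumes perm: "\<pi> permutes {1..m}"
    and left: "inversion_colouring d {1..m} \<pi> c" and right: "inversion_colouring d {1..n} \<tau> e"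
  shows "inversion_colouring d {1..m+n} (direct_sum m \<pi> \<tau>)
    (\<lambda>p. if p \<le> m then c p else e (p - m))" (is "inversion_colouring d _ ?\<sigma> ?f")
  unfolding inversion_colouring_def
proof (intro conjI ballI impI)
  fix p assume "p \<in> {1..m+n}"
  then have "p \<in> {1..m} \<or> \<not> p \<le> m \<and> p - m \<in> {1..n}"
    by auto
  then show "?f p < d"
    using inversion_colouring_less[OF left] inversion_colouring_less[OF right] by auto
next
  fix p q assume inversion: "p \<in> {1..m+n}" "q \<in> {1..m+n}" "p < q \<and> ?\<sigma> q < ?\<sigma> p"
  consider "p \<le> m" "q \<le> m" | "p \<le> m" "m < q" | "m < p"
    using inversion(3) by linarith
  then show "?f p < ?f q"
  proof cases
    case 1
    then show ?thesis
      using inversion_colouring_mono[OF left, of p q] inversion by (auto simp: direct_sum_def)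
  next
    case 2
    then have "?\<sigma> p \<le> ?\<sigma> q"
      using permutes_le_iff[OF perm, of p] by (simp add: direct_sum_def)
    then show ?thesis
      using inversion(3) by simp
  next
    case 3
    then show ?thesis
      using inversion_colouring_mono[OF right, of "p - m" "q - m"] inversion
      by (auto simp: direct_sum_def)
  qed
qed

lemma direct_sum_in_dec_class:
  "\<pi> \<in> dec_class d m \<Longrightarrow> \<tau> \<in> dec_class d n \<Longrightarrow> direct_sum m \<pi> \<tau> \<in> dec_class d (m + n)"
  using direct_sum_permutes inversion_colouring_direct_sum by (meson dec_class_iff)

lemma direct_sum_eqD:
  assumes eq: "direct_sum m \<pi> \<tau> = direct_sum m \<rho> \<sigma>"
    and perm: "\<pi> permutes {1..m}" "\<rho> permutes {1..m}" "\<tau> permutes {1..n}" "\<sigma> permutes {1..n}"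
  shows "\<pi> = \<rho>" "\<tau> = \<sigma>"
proof -
  have "\<pi> p = \<rho> p" for p
    using fun_cong[OF eq, of p] permutes_not_in[OF perm(1), of p] permutes_not_in[OF perm(2), of p]
    by (cases "p \<le> m") (simp_all add: direct_sum_def)
  then show "\<pi> = \<rho>"
    by blast
  have "\<tau> q = \<sigma> q" for q
    using fun_cong[OF eq, of "m + q"] permutes_eq_0_iff[OF perm(3), of q]
      permutes_eq_0_iff[OF perm(4), of q]
    by (cases "q = 0") (simp_all add: direct_sum_def)
  then show "\<tau> = \<sigma>"
    by blast
qed

lemma card_dec_class_add_ge:
  "card (dec_class d m) * card (dec_class d n) \<le> card (dec_class d (m + n))"
proof -
  have "inj_on (\<lambda>(\<pi>, \<tau>). direct_sum m \<pi> \<tau>) (dec_class d m \<times> dec_class d n)"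
  proof (intro inj_onI, clarify)
    fix \<pi> \<tau> \<rho> \<sigma>
    assume "\<pi> \<in> dec_class d m" "\<rho> \<in> dec_class d m" "\<tau> \<in> dec_class d n" "\<sigma> \<in> dec_class d n"
      and "direct_sum m \<pi> \<tau> = direct_sum m \<rho> \<sigma>"
    then show "\<pi> = \<rho> \<and> \<tau> = \<sigma>"
      by (meson dec_class_iff direct_sum_eqD)
  qed
  then have "card (dec_class d m \<times> dec_class d n) \<le> card (dec_class d (m + n))"
    by (rule card_inj_on_le) (auto simp: direct_sum_in_dec_class finite_dec_class)
  then show ?thesis
    by (simp add: card_cartesian_product)
qed

lemma rc_permutes:
  assumes "\<pi> permutes {1..n}"
  shows "rc n \<pi> permutes {1..n}"
proof -
  have "bij_betw (\<lambda>p. n + 1 - p) {1..n} {1..n}"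
    by (rule bij_betw_byWitness[where f' = "\<lambda>p. n + 1 - p"]) auto
  then have "bij_betw ((\<lambda>p. n + 1 - p) \<circ> \<pi> \<circ> (\<lambda>p. n + 1 - p)) {1..n} {1..n}"
    using permutes_imp_bij[OF assms] bij_betw_trans by blast
  then have "bij_betw (rc n \<pi>) {1..n} {1..n}"
    by (rule bij_betw_cong[THEN iffD1, rotated]) (simp add: rc_def)
  then show ?thesis
    by (rule bij_imp_permutes) (auto simp: rc_def)
qed

lemma inversion_colouring_rc:
  assumes perm: "\<pi> permutes {1..n}" and colouring: "inversion_colouring d {1..n} \<pi> c"
  shows "inversion_colouring d {1..n} (rc n \<pi>) (\<lambda>p. d - 1 - c (n + 1 - p))"
  unfolding inversion_colouring_def
proof (intro conjI ballI impI)
  fix p assume "p \<in> {1..n}"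
  then show "d - 1 - c (n + 1 - p) < d"
    using inversion_colouring_less[OF colouring, of p] by auto
next
  fix p q assume inversion: "p \<in> {1..n}" "q \<in> {1..n}" "p < q \<and> rc n \<pi> q < rc n \<pi> p"
  define p' q' where "p' = n + 1 - p" and "q' = n + 1 - q"
  have reflected: "p' \<in> {1..n}" "q' \<in> {1..n}" "q' < p'"
    using inversion by (auto simp: p'_def q'_def)
  have "n + 1 - \<pi> q' < n + 1 - \<pi> p'"
    using inversion(3)
    by (simp only: rc_def if_P[OF inversion(1)] if_P[OF inversion(2)] p'_def q'_def)
  then have "\<pi> p' < \<pi> q'"
    by linarith
  then have "c q' < c p'" "c p' < d"
    using inversion_colouring_mono[OF colouring] inversion_colouring_less[OF colouring] reflected
    by blast+
  then show "d - 1 - c (n + 1 - p) < d - 1 - c (n + 1 - q)"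
    unfolding p'_def[symmetric] q'_def[symmetric] by linarith
qed

lemma rc_in_dec_class: "\<pi> \<in> dec_class d n \<Longrightarrow> rc n \<pi> \<in> dec_class d n"
  using rc_permutes inversion_colouring_rc by (meson dec_class_iff)

lemma rc_rc:
  assumes "\<pi> permutes {1..n}"
  shows "rc n (rc n \<pi>) = \<pi>"
proof
  fix p
  show "rc n (rc n \<pi>) p = \<pi> p"
    using permutes_le_iff[OF assms, of p] permutes_not_in[OF assms, of p] by (auto simp: rc_def)
qed

lemma rc_direct_sum:
  assumes "\<pi> permutes {1..m}" "\<tau> permutes {1..n}"
  shows "rc (m + n) (direct_sum m \<pi> \<tau>) = direct_sum n (rc n \<tau>) (rc m \<pi>)"
proof
  fix p
  consider "p \<notin> {1..m+n}" | "p \<in> {1..n}" | "p \<in> {n+1..n+m}"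
    by fastforce
  then show "rc (m + n) (direct_sum m \<pi> \<tau>) p = direct_sum n (rc n \<tau>) (rc m \<pi>) p"
  proof cases
    case 2
    then have "m + n + 1 - p - m = n + 1 - p" "\<not> m + n + 1 - p \<le> m"
      by auto
    then show ?thesis
      using 2 by (simp add: rc_def direct_sum_def)
  next
    case 3
    then have "m + n + 1 - p = m + 1 - (p - n)" "m + 1 - (p - n) \<le> m"
      by auto
    moreover from this have "\<pi> (m + 1 - (p - n)) \<le> m"
      using permutes_le_iff[OF assms(1)] by blast
    ultimately show ?thesis
      using 3 by (auto simp: rc_def direct_sum_def)
  qed (auto simp: rc_def direct_sum_def)
qed

lemma card_dec_class_le_card_rc_slice:
  "card (dec_class d n) \<le> card (rc_slice (dec_class d) (2 * n))"
proof (rule card_inj_on_le)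
  show "inj_on (\<lambda>\<pi>. direct_sum n \<pi> (rc n \<pi>)) (dec_class d n)"
    by (meson dec_class_iff direct_sum_eqD(1) inj_onI rc_permutes)
  show "(\<lambda>\<pi>. direct_sum n \<pi> (rc n \<pi>)) ` dec_class d n \<subseteq> rc_slice (dec_class d) (2 * n)"
  proof safe
    fix \<pi> assume in_class: "\<pi> \<in> dec_class d n"
    then have perm: "\<pi> permutes {1..n}"
      by (simp add: dec_class_iff)
    have "rc (n + n) (direct_sum n \<pi> (rc n \<pi>)) = direct_sum n \<pi> (rc n \<pi>)"
      by (simp only: rc_direct_sum[OF perm rc_permutes[OF perm]] rc_rc[OF perm])
    then show "direct_sum n \<pi> (rc n \<pi>) \<in> rc_slice (dec_class d) (2 * n)"
      using direct_sum_in_dec_class[OF in_class rc_in_dec_class[OF in_class]]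
      by (simp add: rc_slice_def centrosymmetric_def mult_2)
  qed
qed (rule finite_rc_slice_dec_class)

subsection \<open>Monotone matchings of colourings\<close>

definition monotone_matching ::
  "'a::linorder set \<Rightarrow> ('a \<Rightarrow> 'c) \<Rightarrow> ('a \<Rightarrow> 'c) \<Rightarrow> ('a \<Rightarrow> 'a) \<Rightarrow> bool" where
  "monotone_matching S c e \<pi> \<longleftrightarrow>
     \<pi> permutes S \<and> (\<forall>p\<in>S. e (\<pi> p) = c p) \<and>
     (\<forall>p\<in>S. \<forall>q\<in>S. p < q \<and> c p = c q \<longrightarrow> \<pi> p < \<pi> q)"

lemma monotone_matching_permutes: "monotone_matching S c e \<pi> \<Longrightarrow> \<pi> permutes S"
  by (simp add: monotone_matching_def)

lemma monotone_matching_colour: "monotone_matching S c e \<pi> \<Longrightarrow> p \<in> S \<Longrightarrow> e (\<pi> p) = c p"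
  by (simp add: monotone_matching_def)

lemma monotone_matching_less:
  "monotone_matching S c e \<pi> \<Longrightarrow> p \<in> S \<Longrightarrow> q \<in> S \<Longrightarrow> p < q \<Longrightarrow> c p = c q \<Longrightarrow> \<pi> p < \<pi> q"
  by (simp add: monotone_matching_def)

lemma monotone_matching_less_iff:
  assumes "monotone_matching S c e \<pi>" "p \<in> S" "q \<in> S" "c p = c q"
  shows "\<pi> p < \<pi> q \<longleftrightarrow> p < q"
  using monotone_matching_less[OF assms(1)] assms(2-4) by (metis linorder_neqE order.asym)

lemma monotone_matching_le_if_eq_below:
  assumes match: "monotone_matching S c e \<pi>" and match': "monotone_matching S c e \<tau>"
    and in_S: "p \<in> S" and below: "\<And>q. q \<in> S \<Longrightarrow> q < p \<Longrightarrow> \<pi> q = \<tau> q"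
  shows "\<tau> p \<le> \<pi> p"
proof (rule ccontr)
  assume "\<not> \<tau> p \<le> \<pi> p"
  have "\<pi> p \<in> \<tau> ` S"
    using in_S permutes_in_image[OF monotone_matching_permutes[OF match]]
      permutes_image[OF monotone_matching_permutes[OF match']] by blast
  then obtain q where preimage: "q \<in> S" "\<tau> q = \<pi> p"
    by force
  then have "c q = c p"
    using monotone_matching_colour[OF match in_S] monotone_matching_colour[OF match' preimage(1)]
    by simp
  then have "q < p"
    using monotone_matching_less_iff[OF match' preimage(1) in_S] preimage(2) \<open>\<not> \<tau> p \<le> \<pi> p\<close>
    by (simp add: not_le)
  then have "\<pi> q = \<pi> p"
    using below preimage by simp
  then show False
    using injD[OF permutes_inj[OF monotone_matching_permutes[OF match]]] \<open>q < p\<close> by blast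
qed

lemma monotone_matching_unique:
  fixes \<pi> \<tau> :: "'a::wellorder \<Rightarrow> 'a"
  assumes match: "monotone_matching S c e \<pi>" and match': "monotone_matching S c e \<tau>"
  shows "\<pi> = \<tau>"
proof
  fix p
  show "\<pi> p = \<tau> p"
  proof (induction p rule: less_induct)
    case (less p)
    show ?case
    proof (cases "p \<in> S")
      case True
      then show ?thesis
        using monotone_matching_le_if_eq_below[OF match match']
          monotone_matching_le_if_eq_below[OF match' match]
          less.IH by (metis order.antisym)
    next
      case False
      then show ?thesis
        using permutes_not_in[OF monotone_matching_permutes] match match' by metis
    qed
  qed
qed

lemma ex_strict_mono_bij_betw:
  fixes A B :: "'a::wellorder set"
  assumes "finite A" "finite B" "card A = card B"
  shows "\<exists>h. bij_betw h A B \<and> strict_mono_on A h"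
proof -
  obtain f where enum_A: "bij_betw f {..<card A} A" "strict_mono_on {..<card A} f"
    using ex_bij_betw_strict_mono_card[OF assms(1)] .
  obtain g where enum_B: "bij_betw g {..<card A} B" "strict_mono_on {..<card A} g"
    using ex_bij_betw_strict_mono_card[OF assms(2)] assms(3) by metis
  let ?f' = "inv_into {..<card A} f"
  have "bij_betw ?f' A {..<card A}"
    using enum_A(1) by (rule bij_betw_inv_into)
  moreover have "?f' x < ?f' y" if "x \<in> A" "y \<in> A" "x < y" for x y
    using that bij_betwE[OF \<open>bij_betw ?f' A {..<card A}\<close>] strict_mono_on_less[OF enum_A(2)]
      bij_betw_inv_into_right[OF enum_A(1)] by metis
  ultimately have "bij_betw (g \<circ> ?f') A B" "strict_mono_on A (g \<circ> ?f')"
    using bij_betw_trans[OF _ enum_B(1)] strict_mono_onD[OF enum_B(2)]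
    by (auto simp: strict_mono_on_def dest: bij_betwE)
  then show ?thesis
    by blast
qed

lemma ex_monotone_matching:
  fixes S :: "'a::wellorder set"
  assumes "finite S" "\<And>j. card {p \<in> S. c p = j} = card {p \<in> S. e p = j}"
  shows "\<exists>\<pi>. monotone_matching S c e \<pi>"
proof -
  have "\<exists>h. bij_betw h {p \<in> S. c p = j} {p \<in> S. e p = j} \<and> strict_mono_on {p \<in> S. c p = j} h" for j
    using assms by (intro ex_strict_mono_bij_betw) auto
  then have "\<exists>h. \<forall>j. bij_betw (h j) {p \<in> S. c p = j} {p \<in> S. e p = j} \<and>
      strict_mono_on {p \<in> S. c p = j} (h j)"
    by (intro choice) blast
  then obtain h where bij: "\<And>j. bij_betw (h j) {p \<in> S. c p = j} {p \<in> S. e p = j}"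
    and mono: "\<And>j. strict_mono_on {p \<in> S. c p = j} (h j)"
    by blast
  define \<pi> where "\<pi> p = (if p \<in> S then h (c p) p else p)" for p
  have colour_preserving: "\<pi> p \<in> S" "e (\<pi> p) = c p" if "p \<in> S" for p
    using that bij_betwE[OF bij[of "c p"]] by (auto simp: \<pi>_def)
  have increasing: "\<pi> p < \<pi> q" if "p \<in> S" "q \<in> S" "p < q" "c p = c q" for p q
    using that strict_mono_onD[OF mono[of "c q"], of p q] by (simp add: \<pi>_def)
  have "inj_on \<pi> S"
    using colour_preserving(2) increasing by (metis inj_onI linorder_neqE order.irrefl)
  then have "bij_betw \<pi> S S"
    using endo_inj_surj[OF assms(1)] colour_preserving(1) by (auto simp: bij_betw_def)
  then have "\<pi> permutes S"
    by (rule bij_imp_permutes) (simp add: \<pi>_def)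
  then show ?thesis
    unfolding monotone_matching_def using colour_preserving(2) increasing by blast
qed

lemma inversion_colouring_imp_monotone_matching:
  assumes perm: "\<pi> permutes S" and colouring: "inversion_colouring d S \<pi> c"
  shows "monotone_matching S c (c \<circ> inv \<pi>) \<pi>"
proof -
  have "\<pi> p < \<pi> q" if "p \<in> S" "q \<in> S" "p < q" "c p = c q" for p q
    using that inversion_colouring_mono[OF colouring] injD[OF permutes_inj[OF perm]]
    by (metis linorder_neqE order.irrefl)
  then show ?thesis
    using perm by (auto simp: monotone_matching_def permutes_inverses)
qed

subsection \<open>Upper bound by antisymmetric colourings\<close>

definition antisymmetric_colouring :: "nat \<Rightarrow> nat \<Rightarrow> (nat \<Rightarrow> nat) \<Rightarrow> bool" where
  "antisymmetric_colouring d n c \<longleftrightarrow> (\<forall>p\<in>{1..n}. c p < d \<and> c (n + 1 - p) = d - 1 - c p)"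

lemma centrosymmetric_reflect:
  assumes "centrosymmetric n \<pi>" "\<pi> permutes {1..n}" "p \<in> {1..n}"
  shows "\<pi> (n + 1 - p) = n + 1 - \<pi> p"
proof -
  have "n + 1 - p \<in> {1..n}" "n + 1 - (n + 1 - p) = p"
    using assms(3) by auto
  then have "rc n \<pi> (n + 1 - p) = n + 1 - \<pi> p"
    by (simp only: rc_def if_True)
  then show ?thesis
    using assms(1) by (simp add: centrosymmetric_def)
qed

lemma antisymmetric_colouring_comp_inv:
  assumes antisymmetric: "antisymmetric_colouring d n c"
    and symmetric: "centrosymmetric n \<pi>" "\<pi> permutes {1..n}"
  shows "antisymmetric_colouring d n (c \<circ> inv \<pi>)"
  unfolding antisymmetric_colouring_def
proof (intro ballI)
  fix v assume range_v: "v \<in> {1..n}"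
  define p where "p = inv \<pi> v"
  have range_p: "p \<in> {1..n}"
    using range_v permutes_in_image[OF permutes_inv[OF symmetric(2)]] by (simp add: p_def)
  have "\<pi> (n + 1 - p) = n + 1 - v"
    using centrosymmetric_reflect[OF symmetric range_p] permutes_inverses(1)[OF symmetric(2)]
    by (simp add: p_def)
  then have "inv \<pi> (n + 1 - v) = n + 1 - p"
    using permutes_inverses(2)[OF symmetric(2)] by metis
  then show "(c \<circ> inv \<pi>) v < d \<and> (c \<circ> inv \<pi>) (n + 1 - v) = d - 1 - (c \<circ> inv \<pi>) v"
    using antisymmetric range_p by (simp add: antisymmetric_colouring_def p_def)
qed

lemma antisymmetric_colouring_eqI:
  assumes "antisymmetric_colouring d (2 * n) f" "antisymmetric_colouring d (2 * n) g"
    and half: "\<And>p. p \<in> {1..n} \<Longrightarrow> f p = g p" and range_p: "p \<in> {1..2*n}"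
  shows "f p = g p"
proof (cases "p \<le> n")
  case False
  then have "2 * n + 1 - p \<in> {1..n}" "2 * n + 1 - p \<in> {1..2*n}" "2 * n + 1 - (2 * n + 1 - p) = p"
    using range_p by auto
  then show ?thesis
    using assms(1,2) half unfolding antisymmetric_colouring_def by metis
qed (use half range_p in auto)

text \<open>Average a colouring with its own reflection, rounding down on the left half and up on the
  right half.\<close>

lemma ex_antisymmetric_inversion_colouring:
  assumes "\<pi> \<in> rc_slice (dec_class d) (2 * n)"
  shows "\<exists>c. inversion_colouring d {1..2*n} \<pi> c \<and> antisymmetric_colouring d (2 * n) c"
proof -
  let ?N = "{1..2*n}"
  have perm: "\<pi> permutes ?N" and rc_eq: "rc (2 * n) \<pi> = \<pi>"
    using assms by (auto simp: rc_slice_def centrosymmetric_def dec_class_iff)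
  obtain a where colouring: "inversion_colouring d ?N \<pi> a"
    using assms by (auto simp: rc_slice_def dec_class_iff)
  define b where "b p = d - 1 - a (2 * n + 1 - p)" for p
  have reflected_colouring: "inversion_colouring d ?N \<pi> b"
    using inversion_colouring_rc[OF perm colouring] by (simp add: rc_eq b_def[abs_def])
  define c where "c p = (a p + b p + (if p \<le> n then 0 else 1)) div 2" for p
  have bounded: "a p < d" "b p < d" "c p < d" if "p \<in> ?N" for p
    using inversion_colouring_less[OF colouring that]
      inversion_colouring_less[OF reflected_colouring that]
    by (auto simp: c_def)
  have "c p < c q" if "p \<in> ?N" "q \<in> ?N" "p < q" "\<pi> q < \<pi> p" for p q
    using inversion_colouring_mono[OF colouring that]
      inversion_colouring_mono[OF reflected_colouring that] that(3)
    by (auto simp: c_def)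
  then have "inversion_colouring d ?N \<pi> c"
    using bounded(3) by (auto simp: inversion_colouring_def)
  moreover have "c (2 * n + 1 - p) = d - 1 - c p" if range_p: "p \<in> ?N" for p
  proof -
    define p' where "p' = 2 * n + 1 - p"
    have reflected: "p' \<in> ?N" "2 * n + 1 - p' = p" "p' \<le> n \<longleftrightarrow> \<not> p \<le> n"
      using range_p by (auto simp: p'_def)
    have "b p = d - 1 - a p'" "b p' = d - 1 - a p"
      by (simp_all only: b_def reflected(2) p'_def[symmetric])
    then have "a p + b p + (a p' + b p') = 2 * (d - 1)"
      using bounded(1)[OF range_p] bounded(1)[OF reflected(1)] by linarith
    then show ?thesis
      unfolding p'_def[symmetric] c_def using reflected(3) by (cases "p \<le> n") (simp; presburger)+
  qed
  ultimately show ?thesis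
    using bounded(3) by (auto simp: antisymmetric_colouring_def)
qed

lemma centrosymmetric_eqI:
  assumes first: "\<pi> permutes {1..2*n}" "centrosymmetric (2 * n) \<pi>"
      "inversion_colouring d {1..2*n} \<pi> c" "antisymmetric_colouring d (2 * n) c"
    and second: "\<tau> permutes {1..2*n}" "centrosymmetric (2 * n) \<tau>"
      "inversion_colouring d {1..2*n} \<tau> e" "antisymmetric_colouring d (2 * n) e"
    and position_colours: "\<And>p. p \<in> {1..n} \<Longrightarrow> c p = e p"
    and value_colours: "\<And>v. v \<in> {1..n} \<Longrightarrow> c (inv \<pi> v) = e (inv \<tau> v)"
  shows "\<pi> = \<tau>"
proof -
  have "c p = e p" if "p \<in> {1..2*n}" for p
    using antisymmetric_colouring_eqI[OF first(4) second(4) position_colours that] .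
  moreover have "c (inv \<pi> v) = e (inv \<tau> v)" if "v \<in> {1..2*n}" for v
    using antisymmetric_colouring_eqI[OF antisymmetric_colouring_comp_inv[OF first(4,2,1)]
        antisymmetric_colouring_comp_inv[OF second(4,2,1)] _ that] value_colours by simp
  moreover have "monotone_matching {1..2*n} e (e \<circ> inv \<tau>) \<tau>"
    using inversion_colouring_imp_monotone_matching[OF second(1,3)] .
  ultimately have "monotone_matching {1..2*n} c (c \<circ> inv \<pi>) \<tau>"
    using permutes_in_image[OF second(1)] by (simp add: monotone_matching_def)
  then show ?thesis
    using inversion_colouring_imp_monotone_matching[OF first(1,3)] monotone_matching_unique by blast
qed

lemma card_rc_slice_dec_class_le: "card (rc_slice (dec_class d) (2 * n)) \<le> d ^ (2 * n)"
proof -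
  let ?A = "rc_slice (dec_class d) (2 * n)" and ?W = "{1..n} \<rightarrow>\<^sub>E {..<d}"
  have symmetric: "\<pi> permutes {1..2*n}" "centrosymmetric (2 * n) \<pi>" if "\<pi> \<in> ?A" for \<pi>
    using that by (auto simp: rc_slice_def dec_class_iff)
  have "\<exists>c. inversion_colouring d {1..2*n} \<pi> c \<and> antisymmetric_colouring d (2 * n) c"
    if "\<pi> \<in> ?A" for \<pi>
    using ex_antisymmetric_inversion_colouring[OF that] .
  then obtain col where colouring: "\<And>\<pi>. \<pi> \<in> ?A \<Longrightarrow> inversion_colouring d {1..2*n} \<pi> (col \<pi>)"
    "\<And>\<pi>. \<pi> \<in> ?A \<Longrightarrow> antisymmetric_colouring d (2 * n) (col \<pi>)"
    by metis
  define code where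
    "code \<pi> = (restrict (col \<pi>) {1..n}, restrict (col \<pi> \<circ> inv \<pi>) {1..n})" for \<pi>
  have "inj_on code ?A"
  proof (rule inj_onI)
    fix \<pi> \<tau> assume in_slice: "\<pi> \<in> ?A" "\<tau> \<in> ?A" and same_code: "code \<pi> = code \<tau>"
    have "col \<pi> p = col \<tau> p" "col \<pi> (inv \<pi> p) = col \<tau> (inv \<tau> p)" if "p \<in> {1..n}" for p
    proof -
      have "restrict (col \<pi>) {1..n} p = restrict (col \<tau>) {1..n} p"
        "restrict (col \<pi> \<circ> inv \<pi>) {1..n} p = restrict (col \<tau> \<circ> inv \<tau>) {1..n} p"
        using same_code by (simp_all add: code_def)
      then show "col \<pi> p = col \<tau> p" "col \<pi> (inv \<pi> p) = col \<tau> (inv \<tau> p)"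
        using that by simp_all
    qed
    then show "\<pi> = \<tau>"
      using centrosymmetric_eqI[OF symmetric[OF in_slice(1)] colouring[OF in_slice(1)]
          symmetric[OF in_slice(2)] colouring[OF in_slice(2)]] by blast
  qed
  moreover have "code ` ?A \<subseteq> ?W \<times> ?W"
  proof (intro image_subsetI)
    fix \<pi> assume in_slice: "\<pi> \<in> ?A"
    then have "col \<pi> p < d" "(col \<pi> \<circ> inv \<pi>) p < d" if "p \<in> {1..2*n}" for p
      using antisymmetric_colouring_comp_inv[OF colouring(2) symmetric(2,1)] colouring(2) that
      unfolding antisymmetric_colouring_def by blast+
    then show "code \<pi> \<in> ?W \<times> ?W"
      by (auto simp: code_def)
  qed
  ultimately have "card ?A \<le> card (?W \<times> ?W)"
    by (intro card_inj_on_le) (auto intro!: finite_PiE)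
  then show ?thesis
    by (simp add: card_cartesian_product card_PiE power_add mult_2)
qed

subsection \<open>Greedy colourings and ballot matchings\<close>

definition greedy_colouring ::
  "nat \<Rightarrow> 'a::linorder set \<Rightarrow> ('a \<Rightarrow> 'b::linorder) \<Rightarrow> ('a \<Rightarrow> nat) \<Rightarrow> bool" where
  "greedy_colouring d S \<pi> c \<longleftrightarrow>
     inversion_colouring d S \<pi> c \<and>
     (\<forall>p\<in>S. \<forall>j. c p = Suc j \<longrightarrow> (\<exists>q\<in>S. q < p \<and> \<pi> p < \<pi> q \<and> c q = j))"

lemma greedy_colouring_le:
  assumes greedy: "greedy_colouring d S \<pi> c" and colouring: "inversion_colouring d' S \<pi> e"
    and "p \<in> S"
  shows "c p \<le> e p"
  using \<open>p \<in> S\<close>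
proof (induction "c p" arbitrary: p)
  case (Suc j)
  then obtain q where witness: "q \<in> S" "q < p" "\<pi> p < \<pi> q" "c q = j"
    using greedy unfolding greedy_colouring_def by metis
  then have "c q \<le> e q" "e q < e p"
    using Suc.hyps(1) inversion_colouring_mono[OF colouring] Suc.prems by auto
  then show ?case
    using witness(4) Suc.hyps(2) by simp
qed simp

lemma greedy_colouring_unique:
  assumes "greedy_colouring d S \<pi> c" "greedy_colouring d' S \<pi> e" "p \<in> S"
  shows "c p = e p"
proof (rule order.antisym)
  show "c p \<le> e p"
    using greedy_colouring_le[OF assms(1) _ assms(3)] assms(2)
    unfolding greedy_colouring_def by blast
  show "e p \<le> c p"
    using greedy_colouring_le[OF assms(2) _ assms(3)] assms(1)
    unfolding greedy_colouring_def by blast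
qed

definition colour_count :: "'a::ord set \<Rightarrow> ('a \<Rightarrow> 'c) \<Rightarrow> 'c \<Rightarrow> 'a \<Rightarrow> nat" where
  "colour_count S c j t = card {p \<in> S. p < t \<and> c p = j}"

lemma colour_count_mono:
  fixes t t' :: "'a::preorder"
  assumes "finite S" "t \<le> t'"
  shows "colour_count S c j t \<le> colour_count S c j t'"
  unfolding colour_count_def using assms by (intro card_mono) (auto intro: order.strict_trans2)

lemma colour_count_Suc:
  assumes "finite S" "p \<in> S"
  shows "colour_count S c j (Suc p) = (if c p = j then 1 else 0) + colour_count S c j p"
proof (cases "c p = j")
  case True
  then have "{q \<in> S. q < Suc p \<and> c q = j} = insert p {q \<in> S. q < p \<and> c q = j}"
    using assms(2) by auto
  then show ?thesis
    using True assms(1) by (simp add: colour_count_def)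
next
  case False
  then have "{q \<in> S. q < Suc p \<and> c q = j} = {q \<in> S. q < p \<and> c q = j}"
    by (auto simp: less_Suc_eq)
  then show ?thesis
    using False by (simp add: colour_count_def)
qed

lemma colour_count_monotone_matching:
  assumes match: "monotone_matching S c e \<pi>" and in_S: "p \<in> S"
  shows "colour_count S e (c p) (\<pi> p) = colour_count S c (c p) p"
proof -
  have perm: "\<pi> permutes S"
    using match by (rule monotone_matching_permutes)
  have "{y \<in> S. y < \<pi> p \<and> e y = c p} = \<pi> ` {x \<in> S. x < p \<and> c x = c p}"
  proof (intro equalityI subsetI)
    fix y assume below: "y \<in> {y \<in> S. y < \<pi> p \<and> e y = c p}"
    then obtain x where "x \<in> S" "y = \<pi> x"
      using permutes_image[OF perm] by blast
    then show "y \<in> \<pi> ` {x \<in> S. x < p \<and> c x = c p}"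
      using below monotone_matching_less_iff[OF match _ in_S] monotone_matching_colour[OF match]
      by force
  next
    fix y assume "y \<in> \<pi> ` {x \<in> S. x < p \<and> c x = c p}"
    then show "y \<in> {y \<in> S. y < \<pi> p \<and> e y = c p}"
      using monotone_matching_less[OF match _ in_S] monotone_matching_colour[OF match]
        permutes_in_image[OF perm] by auto
  qed
  then show ?thesis
    using card_image[OF inj_on_subset[OF permutes_inj[OF perm] subset_UNIV]]
    by (simp add: colour_count_def)
qed

definition ballot_colouring :: "nat \<Rightarrow> 'a::ord set \<Rightarrow> ('a \<Rightarrow> nat) \<Rightarrow> bool" where
  "ballot_colouring d S c \<longleftrightarrow>
     (\<forall>p\<in>S. c p < d) \<and>
     (\<forall>t i j. i < j \<and> j < d \<longrightarrow> colour_count S c j t \<le> colour_count S c i t)"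

lemma colour_count_reverse:
  fixes c :: "'a::ord \<Rightarrow> nat"
  assumes "\<forall>p\<in>S. c p < d" "i < d"
  shows "colour_count S (\<lambda>p. d - 1 - c p) i t = colour_count S c (d - 1 - i) t"
proof -
  have "d - 1 - c p = i \<longleftrightarrow> c p = d - 1 - i" if "p \<in> S" for p
    using assms(1)[rule_format, OF that] assms(2) by linarith
  then show ?thesis
    unfolding colour_count_def by (metis (mono_tags, lifting))
qed

lemma ballot_colouring_less: "ballot_colouring d S c \<Longrightarrow> p \<in> S \<Longrightarrow> c p < d"
  by (simp add: ballot_colouring_def)

lemma ballot_colouring_count_less:
  fixes S :: "nat set"
  assumes fin: "finite S" and ballot: "ballot_colouring d S c" and larger: "p \<in> S" "i < c p"
  shows "colour_count S c (c p) p < colour_count S c i (Suc p)"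
proof -
  have "colour_count S c (c p) p < colour_count S c (c p) (Suc p)"
    using colour_count_Suc[OF fin larger(1), of c "c p"] by simp
  also have "\<dots> \<le> colour_count S c i (Suc p)"
    using ballot larger by (simp add: ballot_colouring_def)
  finally show ?thesis .
qed

lemma ballot_colouring_reverse_count_le:
  assumes "ballot_colouring d S c" "i < j" "j < d"
  shows "colour_count S (\<lambda>p. d - 1 - c p) i t \<le> colour_count S (\<lambda>p. d - 1 - c p) j t"
  using assms colour_count_reverse[of S c d] by (simp add: ballot_colouring_def)

lemma ballot_matching_imp_inversion_colouring:
  fixes S :: "nat set" and f :: "nat \<Rightarrow> nat" and d :: nat
  defines "e \<equiv> \<lambda>v. d - 1 - f v"
  assumes fin: "finite S" and ballot_c: "ballot_colouring d S c"
    and ballot_f: "ballot_colouring d S f"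
    and match: "monotone_matching S c e \<pi>"
  shows "inversion_colouring d S \<pi> c"
  unfolding inversion_colouring_def
proof (intro conjI ballI impI)
  fix p q assume p_in_S: "p \<in> S" and q_in_S: "q \<in> S" and inversion: "p < q \<and> \<pi> q < \<pi> p"
  show "c p < c q"
  proof (rule ccontr)
    assume "\<not> c p < c q"
    moreover have "c p \<noteq> c q"
      using monotone_matching_less[OF match p_in_S q_in_S] inversion by auto
    ultimately have "c q < c p"
      by simp
    have "colour_count S c (c p) p < colour_count S c (c q) (Suc p)"
      by (rule ballot_colouring_count_less[OF fin ballot_c p_in_S \<open>c q < c p\<close>])
    also have "\<dots> \<le> colour_count S c (c q) q"
      using inversion by (intro colour_count_mono[OF fin]) simp
    also have "\<dots> = colour_count S e (c q) (\<pi> q)"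
      by (rule colour_count_monotone_matching[OF match q_in_S, symmetric])
    also have "\<dots> \<le> colour_count S e (c p) (\<pi> q)"
      unfolding e_def
      by (rule ballot_colouring_reverse_count_le[OF ballot_f \<open>c q < c p\<close>
            ballot_colouring_less[OF ballot_c p_in_S]])
    also have "\<dots> \<le> colour_count S e (c p) (\<pi> p)"
      using inversion by (intro colour_count_mono[OF fin]) simp
    also have "\<dots> = colour_count S c (c p) p"
      by (rule colour_count_monotone_matching[OF match p_in_S])
    finally show False
      by simp
  qed
qed (rule ballot_colouring_less[OF ballot_c])

lemma ballot_matching_ex_inversion:
  fixes S :: "nat set" and f :: "nat \<Rightarrow> nat" and d :: nat
  defines "e \<equiv> \<lambda>v. d - 1 - f v"
  assumes fin: "finite S" and ballot_c: "ballot_colouring d S c"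
    and ballot_f: "ballot_colouring d S f"
    and match: "monotone_matching S c e \<pi>" and in_S: "p \<in> S" and colour_p: "c p = Suc j"
  shows "\<exists>q\<in>S. q < p \<and> \<pi> p < \<pi> q \<and> c q = j"
proof (rule ccontr)
  assume no_inversion: "\<not> ?thesis"
  have perm: "\<pi> permutes S"
    using match by (rule monotone_matching_permutes)
  have "\<pi> q < \<pi> p" if "q \<in> S" "q < p" "c q = j" for q
    using no_inversion that injD[OF permutes_inj[OF perm], of p q]
    by (metis linorder_neqE_nat order.irrefl)
  then have "\<pi> ` {q \<in> S. q < p \<and> c q = j} \<subseteq> {v \<in> S. v < \<pi> p \<and> e v = j}"
    using monotone_matching_colour[OF match] permutes_in_image[OF perm] by auto
  then have matched: "colour_count S c j p \<le> colour_count S e j (\<pi> p)"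
    unfolding colour_count_def using fin permutes_inj[OF perm]
    by (intro card_inj_on_le) (auto intro: inj_on_subset)
  have "colour_count S c (c p) p < colour_count S c j (Suc p)"
    using colour_p by (intro ballot_colouring_count_less[OF fin ballot_c in_S]) simp
  also have "\<dots> = colour_count S c j p"
    using colour_count_Suc[OF fin in_S, of c j] colour_p by simp
  also note matched
  also have "colour_count S e j (\<pi> p) \<le> colour_count S e (c p) (\<pi> p)"
    unfolding e_def using colour_p ballot_colouring_less[OF ballot_c in_S]
    by (intro ballot_colouring_reverse_count_le[OF ballot_f]) simp_all
  also have "\<dots> = colour_count S c (c p) p"
    by (rule colour_count_monotone_matching[OF match in_S])
  finally show False
    by simp
qed

lemma ballot_matching_imp_greedy_colouring:
  fixes S :: "nat set"
  assumes "finite S" "ballot_colouring d S c" "ballot_colouring d S f"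
    and "monotone_matching S c (\<lambda>v. d - 1 - f v) \<pi>"
  shows "greedy_colouring d S \<pi> c"
  unfolding greedy_colouring_def
  using ballot_matching_imp_inversion_colouring[OF assms] ballot_matching_ex_inversion[OF assms]
  by blast

subsection \<open>Permutations from pairs of ballot words\<close>

definition content_words :: "nat \<Rightarrow> (nat \<Rightarrow> nat) \<Rightarrow> nat list set" where
  "content_words d \<kappa> = {w. set w \<subseteq> {..<d} \<and> (\<forall>j<d. count_list w j = \<kappa> j)}"

definition ballot :: "nat \<Rightarrow> nat \<Rightarrow> nat list \<Rightarrow> bool" where
  "ballot d s w \<longleftrightarrow>
     (\<forall>t i j. i < j \<and> j < d \<longrightarrow> count_list (take t w) j \<le> count_list (take t w) i + s)"

definition ballot_words :: "nat \<Rightarrow> nat \<Rightarrow> nat \<Rightarrow> nat list set" where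
  "ballot_words d s m = {w \<in> content_words d (\<lambda>_. m). ballot d s w}"

lemma length_content_words: "w \<in> content_words d \<kappa> \<Longrightarrow> length w = (\<Sum>j<d. \<kappa> j)"
  using sum_count_set[of w "{..<d}"] by (simp add: content_words_def)

lemma finite_content_words: "finite (content_words d \<kappa>)"
  by (rule finite_subset[OF _ finite_lists_length_eq[of "{..<d}" "\<Sum>j<d. \<kappa> j"]])
    (use length_content_words in \<open>auto simp: content_words_def\<close>)

lemma length_ballot_words: "w \<in> ballot_words d s m \<Longrightarrow> length w = d * m"
  using length_content_words[of w d "\<lambda>_. m"] by (simp add: ballot_words_def)

lemma finite_ballot_words: "finite (ballot_words d s m)"
  by (rule finite_subset[OF _ finite_content_words]) (auto simp: ballot_words_def)

definition letter_at :: "'a list \<Rightarrow> nat \<Rightarrow> 'a" where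
  "letter_at w p = w ! (p - 1)"

lemma letter_at_eqI:
  assumes "length u = n" "length v = n" "\<And>p. p \<in> {1..n} \<Longrightarrow> letter_at u p = letter_at v p"
  shows "u = v"
proof (rule nth_equalityI)
  show "u ! i = v ! i" if "i < length u" for i
    using assms(1) assms(3)[of "Suc i"] that by (simp add: letter_at_def)
qed (use assms in simp)

lemma colour_count_letter_at:
  "colour_count {1..length w} (letter_at w) j (Suc t) = count_list (take t w) j"
proof -
  have "bij_betw (\<lambda>p. p - 1) {p \<in> {1..length w}. p < Suc t \<and> letter_at w p = j}
      {i. i < length (take t w) \<and> j = take t w ! i}"
    by (rule bij_betw_byWitness[where f' = Suc]) (auto simp: letter_at_def)
  then show ?thesis
    unfolding colour_count_def count_list_eq_length_filter length_filter_conv_card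
    by (rule bij_betw_same_card)
qed

lemma ballot_colouring_letter_at:
  assumes "w \<in> ballot_words d 0 m"
  shows "ballot_colouring d {1..d*m} (letter_at w)"
proof -
  have len: "length w = d * m"
    using assms by (rule length_ballot_words)
  have "letter_at w p < d" if "p \<in> {1..d*m}" for p
  proof -
    have "letter_at w p \<in> set w"
      using that len by (auto simp: letter_at_def)
    then show ?thesis
      using assms by (auto simp: ballot_words_def content_words_def)
  qed
  moreover have "colour_count {1..d*m} (letter_at w) j t \<le> colour_count {1..d*m} (letter_at w) i t"
    if "i < j" "j < d" for i j t
    using assms that colour_count_letter_at[of w] len
    by (cases t) (auto simp: ballot_words_def ballot_def colour_count_def)
  ultimately show ?thesis
    by (simp add: ballot_colouring_def)
qed

lemma card_letter_at_ballot_words: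
  assumes "w \<in> ballot_words d s m" "j < d"
  shows "card {p \<in> {1..d*m}. letter_at w p = j} = m"
proof -
  have "{p \<in> {1..length w}. letter_at w p = j} =
      {p \<in> {1..length w}. p < Suc (length w) \<and> letter_at w p = j}"
    by auto
  then have "card {p \<in> {1..length w}. letter_at w p = j} = count_list w j"
    using colour_count_letter_at[of w j "length w"] by (simp add: colour_count_def)
  then show ?thesis
    using assms length_ballot_words[OF assms(1)] by (simp add: ballot_words_def content_words_def)
qed

lemma ex_ballot_matching:
  assumes u_ballot: "u \<in> ballot_words d 0 m" and v_ballot: "v \<in> ballot_words d 0 m"
  shows "\<exists>\<pi>. monotone_matching {1..d*m} (letter_at u) (\<lambda>y. d - 1 - letter_at v y) \<pi>"
proof (rule ex_monotone_matching)
  fix j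
  let ?S = "{1..d*m}"
  have less: "letter_at u p < d" "letter_at v p < d" if "p \<in> ?S" for p
    using ballot_colouring_less[OF ballot_colouring_letter_at] u_ballot v_ballot that by blast+
  show "card {p \<in> ?S. letter_at u p = j} = card {y \<in> ?S. d - 1 - letter_at v y = j}"
  proof (cases "j < d")
    case True
    then have "{y \<in> ?S. d - 1 - letter_at v y = j} = {y \<in> ?S. letter_at v y = d - 1 - j}"
      using less(2) by fastforce
    then show ?thesis
      using True card_letter_at_ballot_words[OF u_ballot] card_letter_at_ballot_words[OF v_ballot]
      by simp
  next
    case False
    have "{p \<in> ?S. letter_at u p = j} = {}" "{y \<in> ?S. d - 1 - letter_at v y = j} = {}"
      using False less by fastforce+
    then show ?thesis
      by (simp only:)
  qed
qed simp

lemma ballot_matching_greedy_letter_at: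
  assumes "u \<in> ballot_words d 0 m" "v \<in> ballot_words d 0 m"
    and "monotone_matching {1..d*m} (letter_at u) (\<lambda>y. d - 1 - letter_at v y) \<pi>"
  shows "greedy_colouring d {1..d*m} \<pi> (letter_at u)"
  by (intro ballot_matching_imp_greedy_colouring[OF _ _ _ assms(3)] ballot_colouring_letter_at
      assms(1,2)) simp

lemma ballot_matching_words_unique:
  assumes u_ballot: "u \<in> ballot_words d 0 m" "u' \<in> ballot_words d 0 m"
    and v_ballot: "v \<in> ballot_words d 0 m" "v' \<in> ballot_words d 0 m"
    and match: "monotone_matching {1..d*m} (letter_at u) (\<lambda>y. d - 1 - letter_at v y) \<pi>"
      "monotone_matching {1..d*m} (letter_at u') (\<lambda>y. d - 1 - letter_at v' y) \<pi>"
  shows "u = u'" "v = v'"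
proof -
  let ?S = "{1..d*m}"
  have letters: "letter_at u p = letter_at u' p" if "p \<in> ?S" for p
    using ballot_matching_greedy_letter_at[OF u_ballot(1) v_ballot(1) match(1)]
      ballot_matching_greedy_letter_at[OF u_ballot(2) v_ballot(2) match(2)] that
    by (rule greedy_colouring_unique)
  then show "u = u'"
    using letter_at_eqI length_ballot_words u_ballot by metis
  have "letter_at v y = letter_at v' y" if range_y: "y \<in> ?S" for y
  proof -
    have "y \<in> \<pi> ` ?S"
      using range_y permutes_image[OF monotone_matching_permutes[OF match(1)]] by simp
    then obtain p where preimage: "p \<in> ?S" "\<pi> p = y"
      by (metis imageE)
    have "d - 1 - letter_at v y = d - 1 - letter_at v' y"
      using monotone_matching_colour[OF match(1) preimage(1)]
        monotone_matching_colour[OF match(2) preimage(1)]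
        letters[OF preimage(1)] preimage(2) by simp
    moreover have "letter_at v y < d" "letter_at v' y < d"
      using ballot_colouring_less[OF ballot_colouring_letter_at] v_ballot range_y by blast+
    ultimately show ?thesis
      by linarith
  qed
  then show "v = v'"
    using letter_at_eqI length_ballot_words v_ballot by metis
qed

lemma card_ballot_words_power2_le: "(card (ballot_words d 0 m))\<^sup>2 \<le> card (dec_class d (d * m))"
proof -
  let ?W = "ballot_words d 0 m" and ?S = "{1..d*m}"
  have "\<exists>\<pi>. monotone_matching ?S (letter_at u) (\<lambda>y. d - 1 - letter_at v y) \<pi>"
    if "u \<in> ?W" "v \<in> ?W" for u v
    using ex_ballot_matching[OF that] .
  then obtain \<Phi> where match: "\<And>u v. u \<in> ?W \<Longrightarrow> v \<in> ?W \<Longrightarrow>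
      monotone_matching ?S (letter_at u) (\<lambda>y. d - 1 - letter_at v y) (\<Phi> u v)"
    by metis
  have "inj_on (\<lambda>(u, v). \<Phi> u v) (?W \<times> ?W)"
  proof (intro inj_onI, clarify)
    fix u v u' v' assume u_ballot: "u \<in> ?W" "u' \<in> ?W" and v_ballot: "v \<in> ?W" "v' \<in> ?W"
      and same_matching: "\<Phi> u v = \<Phi> u' v'"
    show "u = u' \<and> v = v'"
      using ballot_matching_words_unique[OF u_ballot v_ballot
          match[OF u_ballot(1) v_ballot(1), unfolded same_matching]
          match[OF u_ballot(2) v_ballot(2)]] by blast
  qed
  moreover have "\<Phi> u v \<in> dec_class d (d * m)" if "u \<in> ?W" "v \<in> ?W" for u v
    using monotone_matching_permutes[OF match[OF that]]
      ballot_matching_greedy_letter_at[OF that match[OF that]]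
    unfolding dec_class_iff greedy_colouring_def by blast
  then have "(\<lambda>(u, v). \<Phi> u v) ` (?W \<times> ?W) \<subseteq> dec_class d (d * m)"
    by auto
  ultimately have "card (?W \<times> ?W) \<le> card (dec_class d (d * m))"
    by (rule card_inj_on_le) (rule finite_dec_class)
  then show ?thesis
    by (simp add: card_cartesian_product power2_eq_square)
qed

subsection \<open>Counting words with prescribed content\<close>

lemma card_append_le:
  assumes "finite C" "\<And>u. u \<in> A \<Longrightarrow> length u = l" "\<And>u v. u \<in> A \<Longrightarrow> v \<in> B \<Longrightarrow> u @ v \<in> C"
  shows "card A * card B \<le> card C"
proof -
  have "inj_on (\<lambda>(u, v). u @ v) (A \<times> B)"
    using assms(2) by (auto simp: inj_on_def)
  moreover have "(\<lambda>(u, v). u @ v) ` (A \<times> B) \<subseteq> C"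
    using assms(3) by auto
  ultimately have "card (A \<times> B) \<le> card C"
    by (rule card_inj_on_le) (rule assms(1))
  then show ?thesis
    by (simp add: card_cartesian_product)
qed

lemma content_words_append:
  "u \<in> content_words d \<kappa> \<Longrightarrow> v \<in> content_words d \<mu> \<Longrightarrow> u @ v \<in> content_words d (\<lambda>j. \<kappa> j + \<mu> j)"
  by (auto simp: content_words_def)

lemma content_words_cong:
  "(\<And>j. j < d \<Longrightarrow> \<kappa> j = \<mu> j) \<Longrightarrow> content_words d \<kappa> = content_words d \<mu>"
  by (auto simp: content_words_def)

lemma card_content_words_prod_le:
  "(\<Prod>r<e::nat. card (content_words d (\<kappa> r))) \<le> card (content_words d (\<lambda>j. \<Sum>r<e. \<kappa> r j))"
proof (induction e)
  case 0
  have "[] \<in> content_words d (\<lambda>_. 0)"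
    by (simp add: content_words_def)
  then have "0 < card (content_words d (\<lambda>_. 0))"
    using finite_content_words card_gt_0_iff by blast
  then show ?case
    by simp
next
  case (Suc e)
  let ?\<mu> = "\<lambda>j. \<Sum>r<e. \<kappa> r j"
  have "(\<Prod>r<Suc e. card (content_words d (\<kappa> r)))
      \<le> card (content_words d ?\<mu>) * card (content_words d (\<kappa> e))"
    using Suc.IH by simp
  also have "\<dots> \<le> card (content_words d (\<lambda>j. ?\<mu> j + \<kappa> e j))"
    by (intro card_append_le[OF finite_content_words length_content_words content_words_append])
  finally show ?case
    by simp
qed

lemma count_list_map_inj_on:
  assumes "inj_on f A" "set w \<subseteq> A" "x \<in> A"
  shows "count_list (map f w) (f x) = count_list w x"
  using assms(2) by (induction w) (use assms in \<open>auto dest: inj_onD\<close>)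

lemma card_content_words_reindex_le:
  assumes "bij_betw \<phi> {..<d} {..<d}"
  shows "card (content_words d \<kappa>) \<le> card (content_words d (\<kappa> \<circ> \<phi>))"
proof (rule card_inj_on_le)
  let ?\<psi> = "inv_into {..<d} \<phi>"
  have inverse_bij: "bij_betw ?\<psi> {..<d} {..<d}"
    using assms by (rule bij_betw_inv_into)
  then have inverse_inj: "inj_on ?\<psi> {..<d}"
    by (rule bij_betw_imp_inj_on)
  show "inj_on (map ?\<psi>) (content_words d \<kappa>)"
  proof (rule inj_onI)
    fix u v assume "u \<in> content_words d \<kappa>" "v \<in> content_words d \<kappa>" "map ?\<psi> u = map ?\<psi> v"
    then show "u = v"
      using inverse_inj map_inj_on[of ?\<psi> u v] by (auto simp: content_words_def intro: inj_on_subset)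
  qed
  show "map ?\<psi> ` content_words d \<kappa> \<subseteq> content_words d (\<kappa> \<circ> \<phi>)"
  proof
    fix v assume "v \<in> map ?\<psi> ` content_words d \<kappa>"
    then obtain w where word: "v = map ?\<psi> w" "set w \<subseteq> {..<d}" "\<And>j. j < d \<Longrightarrow> count_list w j = \<kappa> j"
      by (auto simp: content_words_def)
    have "count_list v j = \<kappa> (\<phi> j)" if "j < d" for j
      using that bij_betwE[OF assms] bij_betw_inv_into_left[OF assms, of j] word
        count_list_map_inj_on[OF inverse_inj word(2), of "\<phi> j"] by simp
    moreover have "set v \<subseteq> {..<d}"
      using word(1,2) bij_betwE[OF inverse_bij] by auto
    ultimately show "v \<in> content_words d (\<kappa> \<circ> \<phi>)"
      by (simp add: content_words_def)
  qed
qed (rule finite_content_words)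

lemma bij_betw_add_mod: "bij_betw (\<lambda>j. (j + r) mod d) {..<d} {..<d::nat}"
proof -
  have "inj_on (\<lambda>j. (j + r) mod d) {..<d}"
  proof (rule linorder_inj_onI')
    fix i j assume ordered: "i < j" "i \<in> {..<d}" "j \<in> {..<d}"
    then have "\<not> d dvd (j + r) - (i + r)"
      by (intro nat_dvd_not_less) auto
    then show "(i + r) mod d \<noteq> (j + r) mod d"
      using mod_eq_dvd_iff_nat[of "i + r" "j + r" d] ordered(1) by auto
  qed
  moreover have "(\<lambda>j. (j + r) mod d) ` {..<d} \<subseteq> {..<d}"
    by auto
  ultimately show ?thesis
    by (simp add: bij_betw_def endo_inj_surj)
qed

text \<open>Concatenate \<open>d\<close> words of content \<open>\<kappa>\<close>, the \<open>r\<close>-th with its letters shifted cyclically by \<open>r\<close>.\<close>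

lemma card_content_words_power_le:
  "card (content_words d \<kappa>) ^ d \<le> card (content_words d (\<lambda>_. \<Sum>j<d. \<kappa> j))"
proof -
  have "card (content_words d \<kappa>) ^ d = (\<Prod>r<d. card (content_words d \<kappa>))"
    by simp
  also have "\<dots> \<le> (\<Prod>r<d. card (content_words d (\<lambda>j. \<kappa> ((j + r) mod d))))"
    using card_content_words_reindex_le[OF bij_betw_add_mod]
    by (intro prod_mono) (simp add: comp_def)
  also have "\<dots> \<le> card (content_words d (\<lambda>j. \<Sum>r<d. \<kappa> ((j + r) mod d)))"
    by (rule card_content_words_prod_le)
  also have "content_words d (\<lambda>j. \<Sum>r<d. \<kappa> ((j + r) mod d)) = content_words d (\<lambda>_. \<Sum>j<d. \<kappa> j)"
    using sum.reindex_bij_betw[OF bij_betw_add_mod, of \<kappa>]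
    by (intro content_words_cong) (simp add: add.commute)
  finally show ?thesis .
qed

lemma ex_large_content_words:
  assumes "1 \<le> d"
  shows "\<exists>\<kappa>. (\<Sum>j<d. \<kappa> j) = B \<and> d ^ B \<le> card (content_words d \<kappa>) * (B + 1) ^ d"
proof -
  let ?W = "{w. set w \<subseteq> {..<d} \<and> length w = B}" and ?K = "{..<d} \<rightarrow>\<^sub>E {..B}"
  let ?content = "\<lambda>w. restrict (count_list w) {..<d}"
  have "?content \<in> ?W \<rightarrow> ?K"
    by (intro funcsetI restrict_PiE_iff[THEN iffD2]) (auto intro: count_le_length)
  then obtain \<kappa> where large: "card ?W \<le> card (?content -` {\<kappa>} \<inter> ?W) * card ?K"
    using pigeonhole_card[of ?content ?W ?K]
    by (auto simp: finite_lists_length_eq finite_PiE PiE_eq_empty_iff)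
  have fibre_subset: "?content -` {\<kappa>} \<inter> ?W \<subseteq> content_words d \<kappa>"
    by (auto simp: content_words_def)
  have "0 < card ?W"
    using assms by (simp add: card_lists_length_eq)
  then have "?content -` {\<kappa>} \<inter> ?W \<noteq> {}"
    using large by (intro notI) (simp only: card.empty mult_0)
  then obtain w where "w \<in> ?content -` {\<kappa>} \<inter> ?W"
    by blast
  then have "w \<in> content_words d \<kappa>" "length w = B"
    using fibre_subset by auto
  then have "(\<Sum>j<d. \<kappa> j) = B"
    using length_content_words[of w d \<kappa>] by simp
  moreover have "d ^ B \<le> card (content_words d \<kappa>) * (B + 1) ^ d"
  proof -
    have "card ?W \<le> card (content_words d \<kappa>) * card ?K"
      using large mult_le_mono1[OF card_mono[OF finite_content_words fibre_subset]]
      by (rule order.trans)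
    then show ?thesis
      by (simp add: card_lists_length_eq card_PiE)
  qed
  ultimately show ?thesis
    by blast
qed

lemma card_balanced_words_ge:
  assumes "1 \<le> d"
  shows "d ^ (d * B) \<le> card (content_words d (\<lambda>_. B)) * (B + 1) ^ (d * d)"
proof -
  obtain \<kappa> where popular: "(\<Sum>j<d. \<kappa> j) = B" "d ^ B \<le> card (content_words d \<kappa>) * (B + 1) ^ d"
    using ex_large_content_words[OF assms] by blast
  have "d ^ (d * B) \<le> (card (content_words d \<kappa>) * (B + 1) ^ d) ^ d"
    using power_mono[OF popular(2), of d] by (simp add: power_mult[symmetric] mult.commute)
  also have "\<dots> = card (content_words d \<kappa>) ^ d * (B + 1) ^ (d * d)"
    by (simp add: power_mult_distrib power_mult)
  also have "\<dots> \<le> card (content_words d (\<lambda>_. B)) * (B + 1) ^ (d * d)"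
    using card_content_words_power_le[of d \<kappa>] popular(1) by (intro mult_le_mono1) simp
  finally show ?thesis .
qed

subsection \<open>Counting ballot words\<close>

lemma count_list_take_le: "count_list (take t w) x \<le> count_list w x"
  using count_list_append[of "take t w" "drop t w" x] by simp

lemma balanced_words_subset_ballot_words: "content_words d (\<lambda>_. m) \<subseteq> ballot_words d m m"
proof
  fix w assume balanced: "w \<in> content_words d (\<lambda>_. m)"
  have "count_list (take t w) j \<le> count_list (take t w) i + m" if "j < d" for t i j
    using count_list_take_le[of t w j] balanced that by (auto simp: content_words_def)
  then show "w \<in> ballot_words d m m"
    using balanced by (auto simp: ballot_words_def ballot_def)
qed

lemma ballot_append:
  assumes left: "u \<in> content_words d \<kappa>" "ballot d s u" and right: "ballot d s' v"
    and lead: "\<And>i j. i < j \<Longrightarrow> j < d \<Longrightarrow> \<kappa> j + s' \<le> \<kappa> i + s"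
  shows "ballot d s (u @ v)"
  unfolding ballot_def
proof (intro allI impI)
  fix t i j assume letters: "i < j \<and> j < d"
  show "count_list (take t (u @ v)) j \<le> count_list (take t (u @ v)) i + s"
  proof (cases "t \<le> length u")
    case True
    then show ?thesis
      using left(2) letters by (simp add: ballot_def)
  next
    case False
    have "count_list (take (t - length u) v) j \<le> count_list (take (t - length u) v) i + s'"
      using right letters by (simp add: ballot_def)
    then show ?thesis
      using False left(1) letters lead[of i j] by (simp add: content_words_def)
  qed
qed

lemma ballot_append_sorted:
  assumes left: "u \<in> content_words d \<kappa>" "ballot d s u" and right: "v \<in> content_words d \<mu>" "sorted v"
    and lead: "\<And>i j. i < j \<Longrightarrow> j < d \<Longrightarrow> \<kappa> j \<le> \<kappa> i + s"
      "\<And>i j. i < j \<Longrightarrow> j < d \<Longrightarrow> \<kappa> j + \<mu> j \<le> \<kappa> i + \<mu> i + s"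
  shows "ballot d s (u @ v)"
  unfolding ballot_def
proof (intro allI impI)
  fix t i j assume letters: "i < j \<and> j < d"
  define prefix where "prefix = take (t - length u) v"
  have "\<kappa> j + count_list prefix j \<le> \<kappa> i + count_list prefix i + s"
  proof (cases "j \<in> set prefix")
    case True
    have split: "v = prefix @ drop (t - length u) v"
      by (simp add: prefix_def)
    then have "i \<notin> set (drop (t - length u) v)"
      using right(2) True letters by (metis sorted_append leD)
    then have "count_list prefix i = \<mu> i"
      using arg_cong[OF split, of "\<lambda>w. count_list w i"] right(1) letters
      by (simp add: content_words_def)
    moreover have "count_list prefix j \<le> \<mu> j"
      using count_list_take_le[of "t - length u" v j] right(1) letters
      by (simp add: content_words_def prefix_def)
    ultimately show ?thesis
      using lead(2)[of i j] letters by simp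
  qed (use lead(1)[of i j] letters in simp)
  then show "count_list (take t (u @ v)) j \<le> count_list (take t (u @ v)) i + s"
    using left letters
    by (cases "t \<le> length u") (auto simp: content_words_def ballot_def prefix_def)
qed

lemma ballot_words_append:
  assumes "u \<in> ballot_words d s m" "v \<in> ballot_words d s m'"
  shows "u @ v \<in> ballot_words d s (m + m')"
  using assms content_words_append[of u d "\<lambda>_. m" v "\<lambda>_. m'"] ballot_append[of u d "\<lambda>_. m" s s v]
  by (simp add: ballot_words_def)

lemma card_ballot_words_power_le:
  "card (ballot_words d s m) ^ T \<le> card (ballot_words d s (T * m))"
proof (induction T)
  case 0
  have "[] \<in> ballot_words d s 0"
    by (simp add: ballot_words_def content_words_def ballot_def)
  then have "0 < card (ballot_words d s 0)"
    using finite_ballot_words card_gt_0_iff by blast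
  then show ?case
    by simp
next
  case (Suc T)
  have "card (ballot_words d s m) ^ Suc T
      \<le> card (ballot_words d s m) * card (ballot_words d s (T * m))"
    using Suc.IH by simp
  also have "\<dots> \<le> card (ballot_words d s (m + T * m))"
    by (intro card_append_le[OF finite_ballot_words length_ballot_words ballot_words_append])
  finally show ?case
    by simp
qed

definition sorted_word :: "nat \<Rightarrow> (nat \<Rightarrow> nat) \<Rightarrow> nat list" where
  "sorted_word d \<kappa> = concat (map (\<lambda>j. replicate (\<kappa> j) j) [0..<d])"

lemma set_sorted_word: "set (sorted_word d \<kappa>) \<subseteq> {..<d}"
  by (auto simp: sorted_word_def)

lemma sorted_sorted_word: "sorted (sorted_word d \<kappa>)"
proof (induction d)
  case (Suc d)
  then show ?case
    using set_sorted_word[of d \<kappa>] by (force simp: sorted_word_def sorted_append)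
qed (simp add: sorted_word_def)

lemma sorted_word_in_content_words: "sorted_word d \<kappa> \<in> content_words d \<kappa>"
proof -
  have "count_list (replicate r x) y = (if x = y then r else 0)" for r and x y :: nat
    by (induction r) auto
  then have "count_list (sorted_word e \<kappa>) j = (if j < e then \<kappa> j else 0)" for e j
    by (induction e) (auto simp: sorted_word_def)
  then show ?thesis
    using set_sorted_word by (simp add: content_words_def)
qed

lemma ballot_sorted_word:
  assumes "\<And>i j. i < j \<Longrightarrow> j < d \<Longrightarrow> \<kappa> j \<le> \<kappa> i"
  shows "ballot d 0 (sorted_word d \<kappa>)"
proof -
  have "[] \<in> content_words d (\<lambda>_. 0)" "ballot d 0 []"
    by (simp_all add: content_words_def ballot_def)
  then have "ballot d 0 ([] @ sorted_word d \<kappa>)"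
    by (rule ballot_append_sorted[OF _ _ sorted_word_in_content_words sorted_sorted_word])
      (simp_all add: assms)
  then show ?thesis
    by simp
qed

lemma padded_ballot_words:
  assumes ballot_w: "w \<in> ballot_words d s m"
  defines "pre \<equiv> sorted_word d (\<lambda>j. (d - 1 - j) * s)" and "suf \<equiv> sorted_word d (\<lambda>j. j * s)"
  shows "pre @ w @ suf \<in> ballot_words d 0 (m + (d - 1) * s)"
proof -
  let ?\<kappa> = "\<lambda>j. (d - 1 - j) * s"
  have pre_content: "pre \<in> content_words d ?\<kappa>" and suf_content: "suf \<in> content_words d (\<lambda>j. j * s)"
    by (simp_all add: pre_def suf_def sorted_word_in_content_words)
  have w_props: "w \<in> content_words d (\<lambda>_. m)" "ballot d s w"
    using ballot_w by (simp_all add: ballot_words_def)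
  have total: "?\<kappa> j + j * s = (d - 1) * s" if "j < d" for j
    using that by (simp flip: add_mult_distrib)
  have lead: "?\<kappa> j + s \<le> ?\<kappa> i" if "i < j" "j < d" for i j
  proof -
    have "(d - 1 - j + 1) * s \<le> ?\<kappa> i"
      using that by (intro mult_le_mono1) simp
    then show ?thesis
      by simp
  qed
  have "?\<kappa> j \<le> ?\<kappa> i" if "i < j" "j < d" for i j
    using lead[OF that] by linarith
  then have "ballot d 0 pre"
    unfolding pre_def by (rule ballot_sorted_word)
  then have pre_w: "ballot d 0 (pre @ w)"
    using ballot_append[OF pre_content _ w_props(2)] lead by simp
  have "ballot d 0 ((pre @ w) @ suf)"
  proof (rule ballot_append_sorted[OF content_words_append[OF pre_content w_props(1)]
        pre_w suf_content])
    show "?\<kappa> j + m \<le> ?\<kappa> i + m + 0" "?\<kappa> j + m + j * s \<le> ?\<kappa> i + m + i * s + 0"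
      if "i < j" "j < d" for i j
      using lead[OF that] total[of i] total[of j] that by linarith+
  qed (simp add: suf_def sorted_sorted_word)
  moreover have "(pre @ w) @ suf \<in> content_words d (\<lambda>j. ?\<kappa> j + m + j * s)"
    by (intro content_words_append pre_content w_props suf_content)
  then have "(pre @ w) @ suf \<in> content_words d (\<lambda>_. m + (d - 1) * s)"
    using total content_words_cong[of d "\<lambda>j. ?\<kappa> j + m + j * s" "\<lambda>_. m + (d - 1) * s"]
    by (simp add: add.commute add.left_commute)
  ultimately show ?thesis
    by (simp add: ballot_words_def)
qed

lemma card_ballot_words_le_padded:
  "card (ballot_words d s m) \<le> card (ballot_words d 0 (m + (d - 1) * s))"
proof (rule card_inj_on_le)
  let ?pad = "\<lambda>w. sorted_word d (\<lambda>j. (d - 1 - j) * s) @ w @ sorted_word d (\<lambda>j. j * s)"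
  show "inj_on ?pad (ballot_words d s m)"
    by (simp add: inj_on_def)
  show "?pad ` ballot_words d s m \<subseteq> ballot_words d 0 (m + (d - 1) * s)"
    using padded_ballot_words by blast
qed (rule finite_ballot_words)

subsection \<open>Growth rates\<close>

lemma supermultiplicative_power_le:
  fixes a :: "nat \<Rightarrow> real"
  assumes super: "\<And>m n. a m * a n \<le> a (m + n)" and ge_1: "\<And>n. 1 \<le> a n"
  shows "a m ^ q \<le> a (q * m)"
proof (induction q)
  case (Suc q)
  then have "a m ^ Suc q \<le> a m * a (q * m)"
    using ge_1[of m] by simp
  also have "\<dots> \<le> a (Suc q * m)"
    using super[of m "q * m"] by simp
  finally show ?case .
qed (simp add: ge_1)

lemma supermultiplicative_root_ge:
  fixes a :: "nat \<Rightarrow> real"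
  assumes super: "\<And>m n. a m * a n \<le> a (m + n)" and ge_1: "\<And>n. 1 \<le> a n" and "0 < m" "0 < n"
  shows "a m powr (1 / real m - 1 / real n) \<le> root n (a n)"
proof -
  have "real n < real (n div m * m + m)"
    unfolding of_nat_less_iff using dividend_less_div_times[OF \<open>0 < m\<close>, of n] by simp
  then have "real n / real m - 1 \<le> real (n div m)"
    using \<open>0 < m\<close> by (simp add: field_simps)
  then have "(real n / real m - 1) / real n \<le> real (n div m) / real n"
    by (rule divide_right_mono) simp
  then have "1 / real m - 1 / real n \<le> real (n div m) / real n"
    using \<open>0 < n\<close> by (simp add: diff_divide_distrib)
  then have "a m powr (1 / real m - 1 / real n) \<le> a m powr (real (n div m) / real n)"
    using ge_1[of m] by (intro powr_mono)
  also have "\<dots> = root n (a m ^ (n div m))"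
    using ge_1[of m] \<open>0 < n\<close> by (simp add: root_powr_inverse powr_powr flip: powr_realpow)
  also have "a m ^ (n div m) \<le> a (n div m * m) * a (n mod m)"
    using mult_mono[OF supermultiplicative_power_le[of a m] ge_1[of "n mod m"], OF super ge_1]
      ge_1[of "n div m * m"] by simp
  also have "\<dots> \<le> a n"
    using super[of "n div m * m" "n mod m"] by simp
  finally show ?thesis
    using \<open>0 < n\<close> by simp
qed

lemma Fekete_LIMSEQ_root:
  fixes a :: "nat \<Rightarrow> real"
  assumes super: "\<And>m n. a m * a n \<le> a (m + n)" and ge_1: "\<And>n. 1 \<le> a n"
    and bdd: "bdd_above ((\<lambda>n. root n (a n)) ` {0<..})"
  shows "(\<lambda>n. root n (a n)) \<longlonglongrightarrow> (SUP n\<in>{0<..}. root n (a n))"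
proof (rule order_tendstoI)
  fix y assume "y < (SUP n\<in>{0<..}. root n (a n))"
  then obtain m where large_root: "0 < m" "y < root m (a m)"
    using less_cSUP_iff[OF _ bdd] by auto
  have "(\<lambda>n. a m powr (1 / real m - 1 / real n)) \<longlonglongrightarrow> a m powr (1 / real m - 0)"
    using ge_1[of m] by (intro tendsto_intros lim_const_over_n) auto
  then have "\<forall>\<^sub>F n in sequentially. y < a m powr (1 / real m - 1 / real n)"
    using large_root ge_1[of m] by (intro order_tendstoD(1)) (auto simp: root_powr_inverse)
  then show "\<forall>\<^sub>F n in sequentially. y < root n (a n)"
    using eventually_gt_at_top[of 0]
  proof eventually_elim
    case (elim n)
    then show ?case
      using supermultiplicative_root_ge[OF super ge_1 large_root(1), of n] by linarith
  qed
next
  fix y assume above: "(SUP n\<in>{0<..}. root n (a n)) < y"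
  show "\<forall>\<^sub>F n in sequentially. root n (a n) < y"
    using eventually_gt_at_top[of 0]
  proof eventually_elim
    case (elim n)
    then have "root n (a n) \<le> (SUP n\<in>{0<..}. root n (a n))"
      using cSUP_upper[OF _ bdd] by simp
    then show ?case
      using above by simp
  qed
qed

lemma root_card_rc_slice_dec_class_le:
  assumes "0 < n"
  shows "root n (card (rc_slice (dec_class d) (2 * n))) \<le> (real d)\<^sup>2"
proof -
  have "real (card (rc_slice (dec_class d) (2 * n))) \<le> real (d ^ (2 * n))"
    by (intro of_nat_mono card_rc_slice_dec_class_le)
  also have "\<dots> = ((real d)\<^sup>2) ^ n"
    by (simp add: power_mult)
  finally show ?thesis
    using assms real_root_le_mono[of n _ "((real d)\<^sup>2) ^ n"] by (simp add: real_root_power_cancel)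
qed

lemma root_card_dec_class_le_root_card_rc_slice:
  "root n (card (dec_class d n)) \<le> root n (card (rc_slice (dec_class d) (2 * n)))"
  using card_dec_class_le_card_rc_slice[of d n] by (cases "n = 0") simp_all

lemma card_dec_class_ge:
  assumes "1 \<le> d"
  shows "d ^ (2 * d * B\<^sup>2)
    \<le> card (dec_class d (d * (B * B + (d - 1) * B))) * (B + 1) ^ (2 * d\<^sup>2 * B)"
proof -
  have "card (content_words d (\<lambda>_. B)) ^ B \<le> card (ballot_words d B B) ^ B"
    by (intro power_mono card_mono finite_ballot_words balanced_words_subset_ballot_words) simp
  also have "\<dots> \<le> card (ballot_words d B (B * B))"
    by (rule card_ballot_words_power_le)
  also have "\<dots> \<le> card (ballot_words d 0 (B * B + (d - 1) * B))"
    by (rule card_ballot_words_le_padded)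
  finally have "(card (content_words d (\<lambda>_. B)) ^ B)\<^sup>2
      \<le> (card (ballot_words d 0 (B * B + (d - 1) * B)))\<^sup>2"
    by (rule power_mono) simp
  also have "\<dots> \<le> card (dec_class d (d * (B * B + (d - 1) * B)))"
    by (rule card_ballot_words_power2_le)
  finally have words: "(card (content_words d (\<lambda>_. B)) ^ B)\<^sup>2 \<le> \<dots>" .
  have "d ^ (2 * d * B\<^sup>2) = ((d ^ (d * B)) ^ B)\<^sup>2"
    by (simp add: power2_eq_square[of B] mult_ac flip: power_mult)
  also have "\<dots> \<le> ((card (content_words d (\<lambda>_. B)) * (B + 1) ^ (d * d)) ^ B)\<^sup>2"
    by (intro power_mono card_balanced_words_ge assms) simp_all
  also have "\<dots> = (card (content_words d (\<lambda>_. B)) ^ B)\<^sup>2 * (B + 1) ^ (2 * d\<^sup>2 * B)"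
    by (simp add: power_mult_distrib power2_eq_square[of d] mult_ac flip: power_mult)
  also have "\<dots> \<le> card (dec_class d (d * (B * B + (d - 1) * B))) * (B + 1) ^ (2 * d\<^sup>2 * B)"
    using words by (rule mult_le_mono1)
  finally show ?thesis .
qed

lemma root_card_dec_class_ge:
  assumes "1 \<le> d" "1 \<le> B"
  defines "n \<equiv> d * (B * B + (d - 1) * B)"
  shows "real d powr (2 * real B / (real B + real d - 1)) /
      (real B + 1) powr (2 * real d / (real B + real d - 1)) \<le> root n (card (dec_class d n))"
proof -
  have pos: "0 < n"
    using assms(1,2) by (simp add: n_def)
  have real_n: "real n = real d * real B * (B + real d - 1)"
    using assms(1) by (simp add: n_def of_nat_diff ring_distribs)
  have root_power: "root n (x ^ e) = x powr (e / n)" if "0 < x" for x :: real and e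
    using that pos by (simp add: root_powr_inverse powr_powr flip: powr_realpow)
  have "real (d ^ (2 * d * B\<^sup>2)) \<le> real (card (dec_class d n) * (B + 1) ^ (2 * d\<^sup>2 * B))"
    unfolding n_def by (intro of_nat_mono card_dec_class_ge assms(1))
  then have "root n (real d ^ (2 * d * B\<^sup>2))
      \<le> root n (card (dec_class d n)) * root n ((real B + 1) ^ (2 * d\<^sup>2 * B))"
    using pos by (simp add: add.commute flip: real_root_mult)
  moreover have "real (2 * d * B\<^sup>2) / n = 2 * real B / (real B + real d - 1)"
    "real (2 * d\<^sup>2 * B) / n = 2 * real d / (real B + real d - 1)"
    using assms(1,2) by (simp_all add: real_n power2_eq_square)
  ultimately show ?thesis
    using assms(1) root_power by (simp add: divide_le_eq)
qed

lemma powr_quotient_LIMSEQ: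
  fixes x :: real
  assumes "0 < x"
  shows "(\<lambda>B. x powr (2 * real B / (real B + x - 1)) / (real B + 1) powr (2 * x / (real B + x - 1)))
    \<longlonglongrightarrow> x\<^sup>2"
proof -
  have "(\<lambda>B. 2 * real B / (real B + x - 1)) \<longlonglongrightarrow> 2"
    by real_asymp
  then have "(\<lambda>B. x powr (2 * real B / (real B + x - 1))) \<longlonglongrightarrow> x powr 2"
    using assms by (intro tendsto_intros) auto
  moreover have "(\<lambda>B. (real B + 1) powr (2 * x / (real B + x - 1))) \<longlonglongrightarrow> 1"
    using assms by real_asymp
  ultimately show ?thesis
    using tendsto_divide assms by fastforce
qed

lemma bdd_above_root_card_dec_class: "bdd_above ((\<lambda>n. root n (card (dec_class d n))) ` {0<..})"
  by (intro bdd_aboveI2[of _ _ "(real d)\<^sup>2"] root_card_rc_slice_dec_class_le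
      order.trans[OF root_card_dec_class_le_root_card_rc_slice]) simp

lemma SUP_root_card_dec_class:
  assumes "1 \<le> d"
  shows "(SUP n\<in>{0<..}. root n (card (dec_class d n))) = (real d)\<^sup>2"
proof (rule order.antisym)
  let ?r = "\<lambda>n. root n (card (dec_class d n))"
  show "(SUP n\<in>{0<..}. ?r n) \<le> (real d)\<^sup>2"
    using order.trans[OF root_card_dec_class_le_root_card_rc_slice root_card_rc_slice_dec_class_le]
    by (intro cSUP_least) auto
  let ?lower = "\<lambda>B. real d powr (2 * real B / (real B + real d - 1)) /
      (real B + 1) powr (2 * real d / (real B + real d - 1))"
  have "?lower B \<le> (SUP n\<in>{0<..}. ?r n)" if "1 \<le> B" for B
  proof -
    have "?lower B \<le> ?r (d * (B * B + (d - 1) * B))"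
      by (rule root_card_dec_class_ge[OF assms that])
    also have "\<dots> \<le> (SUP n\<in>{0<..}. ?r n)"
      using that assms by (intro cSUP_upper bdd_above_root_card_dec_class) simp
    finally show ?thesis .
  qed
  then have "\<exists>B\<^sub>0. \<forall>B\<ge>B\<^sub>0. ?lower B \<le> (SUP n\<in>{0<..}. ?r n)"
    by blast
  moreover have "?lower \<longlonglongrightarrow> (real d)\<^sup>2"
    using assms by (intro powr_quotient_LIMSEQ) simp
  ultimately show "(real d)\<^sup>2 \<le> (SUP n\<in>{0<..}. ?r n)"
    by (rule LIMSEQ_le_const2[rotated])
qed

lemma root_card_dec_class_LIMSEQ: "(\<lambda>n. root n (card (dec_class d n))) \<longlonglongrightarrow> (real d)\<^sup>2"
proof (cases "d = 0")
  case True
  have "card (dec_class d n) = 0" if "0 < n" for n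
    using card_dec_class_le_card_rc_slice[of d n] card_rc_slice_dec_class_le[of d n] True that
    by (simp add: power_0_left)
  then have "root n (card (dec_class d n)) = 0" for n
    by (cases "n = 0") simp_all
  then show ?thesis
    using True by simp
next
  case False
  then have pos: "1 \<le> d"
    by simp
  show ?thesis
    unfolding SUP_root_card_dec_class[OF pos, symmetric]
  proof (rule Fekete_LIMSEQ_root[OF _ _ bdd_above_root_card_dec_class])
    show "real (card (dec_class d m)) * card (dec_class d n) \<le> card (dec_class d (m + n))" for m n
      using of_nat_mono[OF card_dec_class_add_ge[of d m n], where 'a = real] by simp
    have "0 < card (dec_class d n)" for n
      using id_in_dec_class[OF pos] finite_dec_class card_gt_0_iff by blast
    then show "1 \<le> real (card (dec_class d n))" for n
      by (simp add: Suc_le_eq)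
  qed
qed

theorem theorem2p5:
  fixes k :: nat and C :: "nat \<Rightarrow> (nat \<Rightarrow> nat) set"
  assumes "k \<ge> 1"
  defines "C \<equiv> Av k (decreasing_perm k)"
  shows "\<exists>L::real.
           (\<lambda>n. root n (real (card (rc_slice C (2 * n))))) \<longlonglongrightarrow> L \<and>
           (\<lambda>n. root n (real (card (C n)))) \<longlonglongrightarrow> L"
proof -
  obtain d where k_eq: "k = Suc d"
    using assms(1) by (cases k) auto
  then have class_eq: "C = dec_class d"
    by (simp add: C_def dec_class_def)
  have limit: "(\<lambda>n. root n (card (C n))) \<longlonglongrightarrow> (real d)\<^sup>2"
    unfolding class_eq by (rule root_card_dec_class_LIMSEQ)
  have "(\<lambda>n. root n (card (rc_slice C (2 * n)))) \<longlonglongrightarrow> (real d)\<^sup>2"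
  proof (rule tendsto_sandwich[OF _ _ limit tendsto_const])
    show "\<forall>\<^sub>F n in sequentially. root n (card (C n)) \<le> root n (card (rc_slice C (2 * n)))"
      unfolding class_eq by (simp add: root_card_dec_class_le_root_card_rc_slice)
    show "\<forall>\<^sub>F n in sequentially. root n (card (rc_slice C (2 * n))) \<le> (real d)\<^sup>2"
      unfolding class_eq using eventually_gt_at_top[of 0]
      by eventually_elim (rule root_card_rc_slice_dec_class_le)
  qed
  then show ?thesis
    using limit by blast
qed

end
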